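(* Let $n\ge 3$ and let $G=(V,E)$ be the complete undirected graph on $n$ nodes with edge costs $c(e)\in\{1,2\}$ for all $e\in E$. Then the cost of a minimum-cost tour (Hamiltonian cycle) in $G$ is at most $\frac{106}{81}$ times the optimal value of the subtour LP. That is, the integrality gap of the subtour LP for the 1,2-TSP is at most $\frac{106}{81}$.
   Context: The subtour LP for a complete graph $G=(V,E)$ with costs $c$ is: minimize $\sum_{e\in E} c(e)x(e)$ subject to $\sum_{e\in\delta(i)}x(e)=2$ for all $i\in V$; $\sum_{e\in\delta(S)}x(e)\ge 2$ for all $S\subset V$ with $3\le |S|\le |V|-3$; and $0\le x(e)\le 1$ for all $e\in E$. Here $\delta(S)$ denotes the set of edges with exactly one endpoint in $S$, and $\delta(i)=\delta(\{i\})$. The integrality gap is the worst case (supremum over instances) of the ratio of the cost of an optimal tour to the optimal value of this LP. *)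

theory Defs
  imports Complex_Main "HOL-Library.Extended_Real"
begin

definition complete_edges :: "'a set \<Rightarrow> 'a set set" where
  "complete_edges V = {e. e \<subseteq> V \<and> card e = 2}"

definition cut :: "'a set \<Rightarrow> 'a set \<Rightarrow> 'a set set" where
  "cut V S = {e \<in> complete_edges V. card (e \<inter> S) = 1}"

text \<open>The upper bound on the size of \<open>S\<close> is written as \<open>card S + 3 \<le> card V\<close> to avoid
  truncated subtraction. Only the values of \<open>x\<close> on \<open>complete_edges V\<close> are relevant.\<close>

definition subtour_feasible :: "'a set \<Rightarrow> ('a set \<Rightarrow> real) \<Rightarrow> bool" where
  "subtour_feasible V x \<longleftrightarrow>
     (\<forall>i\<in>V. (\<Sum>e\<in>cut V {i}. x e) = 2) \<and>
     (\<forall>S. S \<subset> V \<and> 3 \<le> card S \<and> card S + 3 \<le> card V \<longrightarrow> (\<Sum>e\<in>cut V S. x e) \<ge> 2) \<and>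
     (\<forall>e\<in>complete_edges V. 0 \<le> x e \<and> x e \<le> 1)"

text \<open>For finite \<open>V\<close> with at least three elements the feasible region is nonempty (take
  \<open>x e = 2 / (card V - 1)\<close>) and, up to values outside \<open>complete_edges V\<close>, compact; so the
  infimum below is an attained minimum.\<close>

definition subtour_lp_value :: "'a set \<Rightarrow> ('a set \<Rightarrow> real) \<Rightarrow> real" where
  "subtour_lp_value V c =
     (INF x\<in>{x. subtour_feasible V x}. \<Sum>e\<in>complete_edges V. c e * x e)"

text \<open>A tour is represented by its edge set; \<open>vs\<close> lists the vertices in the order visited.\<close>

definition cycle_edges :: "'a list \<Rightarrow> 'a set set" where
  "cycle_edges vs = {{vs ! i, vs ! (Suc i mod length vs)} |i. i < length vs}"

definition is_tour :: "'a set \<Rightarrow> 'a set set \<Rightarrow> bool" where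
  "is_tour V T \<longleftrightarrow>
     (\<exists>vs. distinct vs \<and> set vs = V \<and> 3 \<le> length vs \<and> T = cycle_edges vs)"

definition min_tour_cost :: "'a set \<Rightarrow> ('a set \<Rightarrow> real) \<Rightarrow> real" where
  "min_tour_cost V c = Min {\<Sum>e\<in>T. c e |T. is_tour V T}"

definition one_two_instance :: "'a set \<Rightarrow> ('a set \<Rightarrow> real) \<Rightarrow> bool" where
  "one_two_instance V c \<longleftrightarrow>
     finite V \<and> 3 \<le> card V \<and> (\<forall>e\<in>complete_edges V. c e \<in> {1, 2})"

text \<open>The supremum is taken in \<open>ereal\<close>, so that it is the true supremum without presupposing
  that the ratios are bounded.\<close>

definition subtour_integrality_gap :: "('a set \<times> ('a set \<Rightarrow> real)) set \<Rightarrow> ereal" where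
  "subtour_integrality_gap I =
     (SUP (V, c)\<in>I. ereal (min_tour_cost V c / subtour_lp_value V c))"

end

theory Submission
  imports Defs "HOL-Library.Disjoint_Sets"
begin

text \<open>Let \<open>n\<close> be the number of vertices, and let \<open>k\<close> be the weight that an LP solution \<open>x\<close> puts on the
  edges of cost 2, so that its cost is \<open>n + k\<close>. A cover of the vertices by \<open>p\<close> disjoint paths of
  cost-1 edges yields a tour of cost at most \<open>n + p\<close>, so it suffices to find a cover with
  \<open>81 p \<le> 25 n + 56 k\<close>.

  Restricting \<open>x\<close> to the cost-1 edges and moving to an extremal fractional 2-matching leaves
  integral edges and vertex-disjoint fractional cycles. Matching each cycle up to one suitably
  chosen vertex gives a path cover in which the total deficiency, the sum of \<open>max 0 (3 - size)\<close>
  over all paths, is at most \<open>2 k\<close>. Among such covers take one with fewest paths. No cost-1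
  edge joins ends of different paths, since merging does not increase the deficiency. Hence the
  LP weight leaving the path ends must, up to \<open>k\<close>, be absorbed by inner vertices, and counting it
  with the degree and cut constraints shows that paths with at most three vertices are
  compensated by longer ones.\<close>

text \<open>This bound alone gives \<open>3 p \<le> n + 2 k\<close> and hence only the factor 4/3;
  the estimate loses nothing when all paths have three vertices. The second count excludes that
  case: a path has surplus 1 if it has at most three vertices and \<open>3 - s\<close> if it has
  \<open>s > 3\<close>, and the surpluses add up to at most \<open>k\<close>. In that count the cut
  constraints are needed only for triangles. A three-vertex path with adjacent ends can be rerouted
  to end in any of its vertices, and the LP weight inside it must be at most 2, where the bounds
  \<open>x e \<le> 1\<close> would allow 3.

  Sizes, deficiencies and surpluses are combined with weights 25, 25 and 6, where
  \<open>81 = 3 * 25 + 6\<close> and \<open>56 = 2 * 25 + 6\<close>.\<close>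

section \<open>Linear systems, rays, transversals and matchings in paths\<close>

lemma homogeneous_system_nontrivial_solution:
  fixes a :: "'j \<Rightarrow> 'i \<Rightarrow> real"
  assumes "finite J" "finite I" "card J < card I"
  shows "\<exists>g. (\<exists>i\<in>I. g i \<noteq> 0) \<and> (\<forall>j\<in>J. (\<Sum>i\<in>I. a j i * g i) = 0)"
  using assms
proof (induction J arbitrary: I a rule: finite_induct)
  case empty
  then have "I \<noteq> {}" by auto
  then show ?case by (intro exI[of _ "\<lambda>_. 1"]) auto
next
  case (insert j J)
  show ?case
  proof (cases "\<forall>i\<in>I. a j i = 0")
    case True
    have "card J < card I" using insert by simp
    then obtain g where "\<exists>i\<in>I. g i \<noteq> 0" "\<forall>j\<in>J. (\<Sum>i\<in>I. a j i * g i) = 0"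
      using insert.IH insert.prems(1) by blast
    with True show ?thesis by auto
  next
    case False
    then obtain p where p: "p \<in> I" "a j p \<noteq> 0" by auto
    define I' where "I' = I - {p}"
    \<comment> \<open>Gaussian elimination: subtracting a multiple of row \<open>j\<close> clears
      column \<open>p\<close>, which leaves one equation and one unknown fewer. Afterwards
      \<open>h\<close> gives \<open>p\<close> the value that row \<open>j\<close> forces.\<close>
    define a' where "a' = (\<lambda>k i. a k i - a k p * a j i / a j p)"
    have fin: "finite I'" using insert.prems by (simp add: I'_def)
    have "card J < card I'"
      using insert p by (simp add: I'_def card_Diff_singleton)
    from insert.IH[OF fin this, of a'] obtain g where
      g: "\<exists>i\<in>I'. g i \<noteq> 0" "\<forall>k\<in>J. (\<Sum>i\<in>I'. a' k i * g i) = 0"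
      by blast
    define s where "s = (\<Sum>i\<in>I'. a j i * g i)"
    define h where "h = g(p := - s / a j p)"
    have I: "I = insert p I'" "p \<notin> I'" using p by (auto simp: I'_def)
    have sum_h: "(\<Sum>i\<in>I. a k i * h i) = a k p * (- s / a j p) + (\<Sum>i\<in>I'. a k i * g i)" for k
    proof -
      have "(\<Sum>i\<in>I'. a k i * h i) = (\<Sum>i\<in>I'. a k i * g i)"
        by (rule sum.cong) (use I in \<open>auto simp: h_def\<close>)
      then show ?thesis using I fin by (simp add: h_def)
    qed
    have "(\<Sum>i\<in>I. a k i * h i) = 0" if "k \<in> J" for k
    proof -
      have "0 = (\<Sum>i\<in>I'. a' k i * g i)" using g that by simp
      also have "\<dots> = (\<Sum>i\<in>I'. a k i * g i) - a k p / a j p * s"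
      proof -
        have "a' k i * g i = a k i * g i - a k p / a j p * (a j i * g i)" for i
          by (simp add: a'_def left_diff_distrib)
        then show ?thesis by (simp add: s_def sum_subtractf sum_distrib_left)
      qed
      finally show ?thesis using sum_h[of k] by simp
    qed
    moreover have "(\<Sum>i\<in>I. a j i * h i) = 0"
      using p by (simp add: sum_h s_def)
    moreover have "\<exists>i\<in>I. h i \<noteq> 0"
      using g(1) I by (metis fun_upd_other h_def insertCI)
    ultimately show ?thesis by blast
  qed
qed

text \<open>The ratio test of the simplex method. A pair \<open>(a, b)\<close> stands for a
  constraint with slack \<open>a\<close> that changes at rate \<open>b\<close> along a ray;
  \<open>t\<close> is the first time at which some slack vanishes.\<close>

lemma ray_leaves_polyhedron:
  fixes C :: "(real \<times> real) set"
  assumes "finite C" and pos: "\<forall>(a, b)\<in>C. a > 0" and neg: "(a0, b0) \<in> C" "b0 < 0"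
  shows "\<exists>t>0. (\<forall>(a, b)\<in>C. a + t * b \<ge> 0) \<and> (\<exists>(a, b)\<in>C. a + t * b = 0)"
proof -
  define B where "B = (\<lambda>(a, b). a / - b) ` {(a, b) \<in> C. b < 0}"
  define t where "t = Min B"
  have "finite {(a, b) \<in> C. b < 0}"
    by (rule finite_subset[OF _ \<open>finite C\<close>]) auto
  then have B: "finite B" "B \<noteq> {}"
    using neg unfolding B_def by auto
  then have "t \<in> B" unfolding t_def by (rule Min_in)
  then obtain a b where ab: "(a, b) \<in> C" "b < 0" "t = a / - b"
    by (auto simp: B_def)
  have "t > 0" using ab pos by (auto simp: divide_pos_neg)
  moreover have "a + t * b = 0" using ab by (simp add: field_simps)
  moreover have "a + t * b \<ge> 0" if "(a, b) \<in> C" for a b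
  proof (cases "b < 0")
    case True
    then have "a / - b \<in> B" using that by (force simp: B_def)
    then have "t \<le> a / - b" unfolding t_def using B by simp
    then have "t * - b \<le> a" using True by (metis pos_le_divide_eq neg_0_less_iff_less)
    then show ?thesis by simp
  next
    case False
    then show ?thesis using pos that \<open>t > 0\<close> by (auto intro!: add_nonneg_nonneg)
  qed
  ultimately show ?thesis using ab(1) by blast
qed

text \<open>Allowing one exceptional set with a single element makes the greedy choice inductive:
  the only set that loses an element becomes the exception, and is treated next.\<close>

lemma independent_transversal:
  fixes r :: "'a \<Rightarrow> 'a \<Rightarrow> bool"
  assumes "finite K" "disjoint_family_on A K"
    and "\<And>i. i \<in> K \<Longrightarrow> finite (A i)" "\<And>i. i \<in> K \<Longrightarrow> A i \<noteq> {}"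
    and "\<And>i. i \<in> K \<Longrightarrow> i \<noteq> j \<Longrightarrow> card (A i) \<ge> 2"
    and r: "\<And>u v w. r u v \<Longrightarrow> r u w \<Longrightarrow> v = w" "\<And>u v. r u v \<Longrightarrow> r v u" "\<And>v. \<not> r v v"
  shows "\<exists>f. (\<forall>i\<in>K. f i \<in> A i) \<and> (\<forall>i\<in>K. \<forall>i'\<in>K. \<not> r (f i) (f i'))"
  using assms(1-5)
proof (induction "card K" arbitrary: K A j)
  case 0
  then show ?case by auto
next
  case (Suc n)
  then have "K \<noteq> {}" by auto
  then obtain p where p: "p \<in> K" "j \<in> K \<Longrightarrow> p = j" by auto
  obtain v where v: "v \<in> A p" using Suc.prems p by blast
  define K' where "K' = K - {p}"
  define A' where "A' = (\<lambda>k. A k - {w. r v w})"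
  have two: "card (A i) \<ge> 2" if "i \<in> K'" for i
    using that p Suc.prems(5)[of i] unfolding K'_def by auto
  have K': "n = card K'" "finite K'"
    using Suc.hyps(2) Suc.prems(1) p by (simp_all add: K'_def)
  have dis: "disjoint_family_on A' K'"
    using Suc.prems(2) unfolding disjoint_family_on_def A'_def K'_def by blast
  have fin: "finite (A' i)" if "i \<in> K'" for i
    using Suc.prems(3)[of i] that by (simp add: A'_def K'_def)
  have ne: "A' i \<noteq> {}" if "i \<in> K'" for i
  proof
    assume "A' i = {}"
    then have *: "A i \<subseteq> {w. r v w}" by (auto simp: A'_def)
    have "card (A i) \<le> 1"
      using Suc.prems(3)[of i] that r(1) * unfolding card_le_Suc0_iff_eq K'_def
      by (metis (no_types, lifting) DiffD1 One_nat_def card_le_Suc0_iff_eq mem_Collect_eq subsetD)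
    then show False using two[OF that] by simp
  qed
  \<comment> \<open>At most one \<open>w\<close> is related to \<open>v\<close>, and by disjointness
    it lies in at most one of the sets.\<close>
  have "\<exists>q. \<forall>i\<in>K'. i \<noteq> q \<longrightarrow> A' i = A i"
  proof (cases "\<exists>q\<in>K'. \<exists>w\<in>A q. r v w")
    case True
    then obtain q w where q: "q \<in> K'" "w \<in> A q" "r v w" by blast
    have "A' i = A i" if "i \<in> K'" "i \<noteq> q" for i
    proof -
      have "w \<notin> A i"
        using Suc.prems(2) that q unfolding disjoint_family_on_def K'_def by blast
      then show ?thesis using r(1) q(3) unfolding A'_def by blast
    qed
    then show ?thesis by blast
  next
    case False
    then show ?thesis unfolding A'_def by blast
  qed
  then obtain q where q: "\<And>i. i \<in> K' \<Longrightarrow> i \<noteq> q \<Longrightarrow> A' i = A i" by blast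
  have "card (A' i) \<ge> 2" if "i \<in> K'" "i \<noteq> q" for i
    using q[OF that] two[OF that(1)] by simp
  from Suc.hyps(1)[OF K' dis fin ne this] obtain f where
    f: "\<forall>i\<in>K'. f i \<in> A' i" "\<forall>i\<in>K'. \<forall>i'\<in>K'. \<not> r (f i) (f i')"
    by blast
  have "\<not> r v (f i)" "\<not> r (f i) v" if "i \<in> K'" for i
    using f(1) that r(2)[of "f i" v] by (auto simp: A'_def)
  then show ?case
    using f v r(3) p(1) unfolding K'_def A'_def
    by (intro exI[of _ "f(p := v)"]) auto
qed

text \<open>Every second edge of the path is taken, starting with the first.\<close>

lemma path_even_matching:
  assumes "successively (\<lambda>u v. {u, v} \<in> F) l" "distinct l" "even (length l)"
  shows "\<exists>D\<subseteq>F. disjoint D \<and> \<Union>D = set l"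
  using assms
proof (induction l rule: induct_list012)
  case 1
  then show ?case by (intro exI[of _ "{}"]) auto
next
  case (2 x)
  then show ?case by simp
next
  case (3 x y zs)
  then have "successively (\<lambda>u v. {u, v} \<in> F) zs" "distinct zs" "even (length zs)"
    by (auto simp: successively_Cons)
  with "3.IH"(1) obtain D where D: "D \<subseteq> F" "disjoint D" "\<Union>D = set zs" by blast
  have "\<forall>d\<in>D. {x, y} \<inter> d = {}" using D(3) 3 by auto
  then have "disjoint (insert {x, y} D)"
    using D(2) by (auto simp: disjoint_def)
  then show ?case using D 3 by (intro exI[of _ "insert {x, y} D"]) auto
qed

subsection \<open>Fractional 2-matchings\<close>

lemma sum_incidences:
  fixes y :: "'a set \<Rightarrow> real"
  assumes "finite S" "finite E"
  shows "(\<Sum>v\<in>S. \<Sum>e\<in>{e \<in> E. v \<in> e}. y e) = (\<Sum>e\<in>E. real (card (e \<inter> S)) * y e)"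
proof -
  have "(\<Sum>v\<in>S. \<Sum>e\<in>{e \<in> E. v \<in> e}. y e) = (\<Sum>v\<in>S. \<Sum>e\<in>E. if v \<in> e then y e else 0)"
    by (rule sum.cong[OF refl], rule sum.inter_filter[OF assms(2)])
  also have "\<dots> = (\<Sum>e\<in>E. \<Sum>v\<in>S. if v \<in> e then y e else 0)"
    by (rule sum.swap)
  also have "\<dots> = (\<Sum>e\<in>E. real (card (e \<inter> S)) * y e)"
  proof (rule sum.cong[OF refl])
    fix e
    have "(\<Sum>v\<in>S. if v \<in> e then y e else 0) = (\<Sum>v\<in>{v \<in> S. v \<in> e}. y e)"
      by (rule sum.inter_filter[OF assms(1), symmetric])
    moreover have "{v \<in> S. v \<in> e} = e \<inter> S" by auto
    ultimately show "(\<Sum>v\<in>S. if v \<in> e then y e else 0) = real (card (e \<inter> S)) * y e"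
      by simp
  qed
  finally show ?thesis .
qed

definition fractional_2_matching :: "'a set \<Rightarrow> 'a set set \<Rightarrow> ('a set \<Rightarrow> real) \<Rightarrow> bool" where
  "fractional_2_matching V E y \<longleftrightarrow>
     (\<forall>e\<in>E. 0 \<le> y e \<and> y e \<le> 1) \<and> (\<forall>v\<in>V. (\<Sum>e\<in>{e \<in> E. v \<in> e}. y e) \<le> 2)"

text \<open>Among the solutions of weight at least that of \<open>y0\<close>, take one with as few fractional edges and
  unsaturated vertices as possible. Then no nonzero direction supported on the fractional edges
  preserves the degrees of the saturated vertices; comparing the number of unknowns with the
  number of equations shows that the fractional edges form a 2-regular graph on saturated
  vertices.\<close>

lemma extremal_fractional_2_matching:
  fixes y0 :: "'a set \<Rightarrow> real"
  assumes V: "finite V" and E: "finite E" "\<And>e. e \<in> E \<Longrightarrow> e \<subseteq> V \<and> card e = 2"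
    and y0: "fractional_2_matching V E y0"
  obtains y where "fractional_2_matching V E y" "sum y E \<ge> sum y0 E"
    "\<And>v. v \<in> V \<Longrightarrow> card {e \<in> E. 0 < y e \<and> y e < 1 \<and> v \<in> e} = 0 \<or>
        card {e \<in> E. 0 < y e \<and> y e < 1 \<and> v \<in> e} = 2 \<and> (\<Sum>e\<in>{e \<in> E. v \<in> e}. y e) = 2"
proof -
  define d where "d = (\<lambda>y v. \<Sum>e\<in>{e \<in> E. v \<in> e}. (y::'a set \<Rightarrow> real) e)"
  define F where "F = (\<lambda>y. {e \<in> E. 0 < (y::'a set \<Rightarrow> real) e \<and> y e < 1})"
  define U where "U = (\<lambda>y. {v \<in> V. d y v < 2})"
  define good where "good = (\<lambda>y. fractional_2_matching V E y \<and> sum y E \<ge> sum y0 E)"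
  have "good y0" using y0 by (simp add: good_def)
  then obtain y where y: "good y"
    and min: "\<And>z. good z \<Longrightarrow> card (F y) + card (U y) \<le> card (F z) + card (U z)"
    using ex_has_least_nat[of good y0 "\<lambda>y. card (F y) + card (U y)"] by blast
  have y01: "0 \<le> y e" "y e \<le> 1" if "e \<in> E" for e
    using y that by (auto simp: good_def fractional_2_matching_def)
  have d2: "d y v \<le> 2" if "v \<in> V" for v
    using y that by (auto simp: good_def fractional_2_matching_def d_def)
  have finF: "finite (F z)" "finite (U z)" for z
    using E V by (auto simp: F_def U_def)
  define T where "T = {v \<in> V. d y v = 2 \<and> (\<exists>e\<in>F y. v \<in> e)}"
  have finT: "finite T" using V by (simp add: T_def)
  have "\<not> card T < card (F y)"
  proof
    assume "card T < card (F y)"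
    from homogeneous_system_nontrivial_solution[OF finT finF(1) this, of "\<lambda>v e. of_bool (v \<in> e)"]
    obtain g0 :: "'a set \<Rightarrow> real" where g0: "\<exists>e\<in>F y. g0 e \<noteq> 0" "\<forall>v\<in>T. (\<Sum>e\<in>F y. of_bool (v \<in> e) * g0 e) = 0"
      by blast
    \<comment> \<open>The sign is chosen so that moving in direction \<open>g\<close> does not
      decrease the total weight.\<close>
    define s :: real where "s = (if (\<Sum>e\<in>F y. g0 e) \<ge> 0 then 1 else - 1)"
    define g where "g = (\<lambda>e. if e \<in> F y then s * g0 e else 0)"
    have s: "s \<noteq> 0" by (simp add: s_def)
    have gsum: "sum g E \<ge> 0"
    proof -
      have "sum g E = sum g (F y)"
        by (rule sum.mono_neutral_right) (use E in \<open>auto simp: g_def F_def\<close>)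
      also have "\<dots> = s * (\<Sum>e\<in>F y. g0 e)" by (simp add: g_def sum_distrib_left)
      also have "\<dots> \<ge> 0" by (simp add: s_def)
      finally show ?thesis .
    qed
    have dg: "d g v = 0" if "v \<in> V" "d y v = 2" for v
    proof -
      have "d g v = (\<Sum>e\<in>F y. of_bool (v \<in> e) * (s * g0 e))"
        unfolding d_def g_def using E(1)
        by (intro sum.mono_neutral_cong) (auto simp: F_def)
      also have "\<dots> = s * (\<Sum>e\<in>F y. of_bool (v \<in> e) * g0 e)"
        by (simp add: sum_distrib_left mult_ac)
      also have "\<dots> = 0"
      proof (cases "v \<in> T")
        case True
        then show ?thesis using g0(2) by simp
      next
        case False
        then have "\<forall>e\<in>F y. v \<notin> e" using that by (auto simp: T_def)
        then show ?thesis by simp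
      qed
      finally show ?thesis .
    qed
    \<comment> \<open>Slack and rate of change of every constraint that is not tight at
      \<open>y\<close>: the two bounds of each fractional edge and the degree bound of each
      unsaturated vertex. When the first of them becomes tight, a fractional edge or an unsaturated
      vertex is lost, contrary to the choice of \<open>y\<close>.\<close>
    define C where "C = (\<lambda>e. (y e, g e)) ` F y \<union> (\<lambda>e. (1 - y e, - g e)) ` F y
      \<union> (\<lambda>v. (2 - d y v, - d g v)) ` U y"
    have finC: "finite C" using finF by (simp add: C_def)
    have posC: "\<forall>(a, b)\<in>C. a > 0"
      by (auto simp: C_def F_def U_def)
    obtain a0 b0 where ab0: "(a0, b0) \<in> C" "b0 < 0"
    proof -
      from g0(1) s obtain e where e: "e \<in> F y" "g e \<noteq> 0" by (auto simp: g_def)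
      then have "(y e, g e) \<in> C" "(1 - y e, - g e) \<in> C" by (auto simp: C_def)
      then show thesis using e(2) that by (cases "g e < 0") auto
    qed
    from ray_leaves_polyhedron[OF finC posC ab0] obtain t where
      t: "t > 0" "\<forall>(a, b)\<in>C. a + t * b \<ge> 0" "\<exists>(a, b)\<in>C. a + t * b = 0"
      by blast
    have tC: "a + t * b \<ge> 0" if "(a, b) \<in> C" for a b
      using t(2) that by blast
    define z where "z = (\<lambda>e. y e + t * g e)"
    have z_eq: "z e = y e + t * g e" for e by (simp add: z_def)
    have z_same: "z e = y e" if "e \<notin> F y" for e
      using that by (simp add: z_def g_def)
    have z01: "0 \<le> z e" "z e \<le> 1" if "e \<in> E" for e
    proof -
      have "0 \<le> z e \<and> z e \<le> 1"
      proof (cases "e \<in> F y")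
        case True
        then have "(y e, g e) \<in> C" "(1 - y e, - g e) \<in> C" by (auto simp: C_def)
        from tC[OF this(1)] tC[OF this(2)] show ?thesis by (simp add: z_def)
      next
        case False
        then show ?thesis using y01[OF that] z_same by simp
      qed
      then show "0 \<le> z e" "z e \<le> 1" by auto
    qed
    have dz: "d z v = d y v + t * d g v" for v
      by (simp add: d_def z_def sum.distrib sum_distrib_left)
    have dz2: "d z v \<le> 2" if "v \<in> V" for v
    proof (cases "d y v = 2")
      case True
      then show ?thesis using dz dg[OF that] by simp
    next
      case False
      then have "v \<in> U y" using d2[OF that] that by (simp add: U_def)
      then have "(2 - d y v, - d g v) \<in> C" by (auto simp: C_def)
      from tC[OF this] show ?thesis by (simp add: dz)
    qed
    have "sum z E = sum y E + t * sum g E"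
      by (simp add: z_def sum.distrib sum_distrib_left)
    then have "sum z E \<ge> sum y E" using gsum t(1) by simp
    then have good: "good z"
      using y z01 dz2 by (auto simp: good_def fractional_2_matching_def d_def)
    have subF: "F z \<subseteq> F y"
      using z_same by (force simp: F_def)
    have subU: "U z \<subseteq> U y"
      using dz dg d2 by (force simp: U_def)
    have "F z \<subset> F y \<or> U z \<subset> U y"
    proof -
      obtain a b where ab: "(a, b) \<in> C" "a + t * b = 0" using t(3) by auto
      from ab(1) consider e where "e \<in> F y" "a = y e" "b = g e"
        | e where "e \<in> F y" "a = 1 - y e" "b = - g e"
        | v where "v \<in> U y" "a = 2 - d y v" "b = - d g v"
        unfolding C_def by blast
      then show ?thesis
      proof cases
        case 1
        have "z e = a + t * b" unfolding 1 z_eq ..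
        then have "z e = 0" unfolding ab(2) .
        then have "e \<notin> F z" by (simp add: F_def)
        then show ?thesis using 1 subF by blast
      next
        case 2
        have "z e = 1 - (a + t * b)" unfolding 2 z_eq by (simp add: algebra_simps)
        then have "z e = 1" unfolding ab(2) by simp
        then have "e \<notin> F z" by (simp add: F_def)
        then show ?thesis using 2 subF by blast
      next
        case 3
        have "d z v = 2 - (a + t * b)" unfolding 3 dz by (simp add: algebra_simps)
        then have "d z v = 2" unfolding ab(2) by simp
        then have "v \<notin> U z" by (simp add: U_def)
        then show ?thesis using 3 subU by blast
      qed
    qed
    then have "card (F z) + card (U z) < card (F y) + card (U y)"
      using psubset_card_mono[OF finF(1), of "F z" y] psubset_card_mono[OF finF(2), of "U z" y]
        card_mono[OF finF(1) subF] card_mono[OF finF(2) subU] by linarith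
    then show False using min[OF good] by simp
  qed
  define fd where "fd = (\<lambda>v. card {e \<in> F y. v \<in> e})"
  \<comment> \<open>If \<open>f\<close> were the only fractional edge at \<open>v\<close>, the
    degree 2 would be \<open>y f\<close> plus an integer.\<close>
  have fdT: "fd v \<ge> 2" if "v \<in> T" for v
  proof (rule ccontr)
    assume "\<not> fd v \<ge> 2"
    moreover have "fd v \<noteq> 0"
      using that finF(1) by (auto simp: fd_def T_def)
    ultimately have "card {e \<in> F y. v \<in> e} = 1" by (simp add: fd_def)
    then obtain f where f: "{e \<in> F y. v \<in> e} = {f}" by (auto simp: card_1_singleton_iff)
    then have f_mem: "f \<in> E" "v \<in> f" "0 < y f" "y f < 1"
      by (auto simp: F_def)
    let ?I = "{e \<in> E. v \<in> e \<and> y e = 1}"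
    have "d y v = sum y ({f} \<union> ?I)"
      unfolding d_def
    proof (rule sum.mono_neutral_right)
      show "\<forall>e\<in>{e \<in> E. v \<in> e} - ({f} \<union> ?I). y e = 0"
      proof
        fix e assume e: "e \<in> {e \<in> E. v \<in> e} - ({f} \<union> ?I)"
        then have "e \<notin> F y" using f by blast
        then show "y e = 0" using e y01[of e] by (auto simp: F_def)
      qed
    qed (use E f_mem in auto)
    also have "\<dots> = y f + sum y ?I" using E(1) f_mem by simp
    also have "sum y ?I = real (card ?I)" by simp
    finally have "y f + real (card ?I) = 2" using that by (simp add: T_def)
    then have "real (card ?I) < 2" "real (card ?I) > 1" using f_mem by linarith+
    then have "card ?I < 2" "card ?I > 1" by simp_all
    then show False by simp
  qed
  \<comment> \<open>Handshake: the degrees \<open>fd\<close> sum to \<open>2 * card (F y)\<close>,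
    which is at most \<open>2 * card T\<close>, while each vertex of \<open>T\<close> already
    contributes at least 2. So equality holds throughout.\<close>
  have "(\<Sum>v\<in>V. fd v) = 2 * card (F y)"
  proof -
    have "real (\<Sum>v\<in>V. fd v) = (\<Sum>v\<in>V. \<Sum>e\<in>{e \<in> F y. v \<in> e}. 1)"
      by (simp add: fd_def)
    also have "\<dots> = (\<Sum>e\<in>F y. real (card (e \<inter> V)) * 1)"
      by (rule sum_incidences[OF V finF(1)])
    also have "\<dots> = (\<Sum>e\<in>F y. 2)"
    proof (rule sum.cong[OF refl])
      fix e assume "e \<in> F y"
      then have "e \<inter> V = e" "card e = 2" using E(2) by (auto simp: F_def)
      then show "real (card (e \<inter> V)) * 1 = 2" by simp
    qed
    finally have "real (\<Sum>v\<in>V. fd v) = real (2 * card (F y))" by simp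
    then show ?thesis by (simp only: of_nat_eq_iff)
  qed
  also have "\<dots> \<le> (\<Sum>v\<in>T. 2)" using \<open>\<not> card T < card (F y)\<close> by simp
  finally have le: "(\<Sum>v\<in>V. fd v) \<le> (\<Sum>v\<in>T. 2)" .
  have split: "(\<Sum>v\<in>V. fd v) = (\<Sum>v\<in>T. fd v) + (\<Sum>v\<in>V - T. fd v)"
  proof -
    have "T \<subseteq> V" by (auto simp: T_def)
    from sum.subset_diff[OF this V, of fd] show ?thesis by linarith
  qed
  have geT: "(\<Sum>v\<in>T. fd v) \<ge> (\<Sum>v\<in>T. 2)" by (rule sum_mono) (rule fdT)
  have "(\<Sum>v\<in>V - T. fd v) = 0" using le split geT by linarith
  then have fd0: "fd v = 0" if "v \<in> V - T" for v using that V by simp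
  have eqT: "(\<Sum>v\<in>T. 2) = (\<Sum>v\<in>T. fd v)" using le split geT by linarith
  have fd2: "fd v = 2" if "v \<in> T" for v
  proof (rule ccontr)
    assume "fd v \<noteq> 2"
    then have "2 < fd v" using fdT[OF that] by simp
    then have "(\<Sum>v\<in>T. 2) < (\<Sum>v\<in>T. fd v)"
      using that fdT by (intro sum_strict_mono_ex1 finT ballI bexI[of _ v])
    then show False using eqT by simp
  qed
  have fd_eq: "{e \<in> E. 0 < y e \<and> y e < 1 \<and> v \<in> e} = {e \<in> F y. v \<in> e}" for v
    by (auto simp: F_def)
  show thesis
  proof (rule that)
    show "fractional_2_matching V E y" "sum y E \<ge> sum y0 E" using y by (auto simp: good_def)
    fix v assume v: "v \<in> V"
    show "card {e \<in> E. 0 < y e \<and> y e < 1 \<and> v \<in> e} = 0 \<or>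
        card {e \<in> E. 0 < y e \<and> y e < 1 \<and> v \<in> e} = 2 \<and> (\<Sum>e\<in>{e \<in> E. v \<in> e}. y e) = 2"
    proof (cases "v \<in> T")
      case True
      then have "d y v = 2" by (simp add: T_def)
      then show ?thesis using fd2[OF True] unfolding fd_eq fd_def d_def by blast
    next
      case False
      then show ?thesis using fd0[of v] v unfolding fd_eq fd_def by blast
    qed
  qed
qed

text \<open>The two fractional edges at a vertex contribute exactly 1, so a single edge of value 1
  remains there.\<close>

lemma half_integral_2_matching:
  fixes y0 :: "'a set \<Rightarrow> real"
  assumes V: "finite V" and E: "finite E" "\<And>e. e \<in> E \<Longrightarrow> e \<subseteq> V \<and> card e = 2"
    and y0: "fractional_2_matching V E y0"
  obtains I F where "I \<subseteq> E" "F \<subseteq> E" "I \<inter> F = {}"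
    "\<forall>v\<in>V. card {e \<in> F. v \<in> e} = 0 \<and> card {e \<in> I. v \<in> e} \<le> 2 \<or>
        card {e \<in> F. v \<in> e} = 2 \<and> card {e \<in> I. v \<in> e} = 1"
    "(\<Sum>v\<in>V - \<Union>F. 2 - real (card {e \<in> I. v \<in> e})) \<le> 2 * (real (card V) - sum y0 E)"
proof -
  obtain y where y: "fractional_2_matching V E y" "sum y E \<ge> sum y0 E"
    "\<And>v. v \<in> V \<Longrightarrow> card {e \<in> E. 0 < y e \<and> y e < 1 \<and> v \<in> e} = 0 \<or>
        card {e \<in> E. 0 < y e \<and> y e < 1 \<and> v \<in> e} = 2 \<and> (\<Sum>e\<in>{e \<in> E. v \<in> e}. y e) = 2"
    using extremal_fractional_2_matching[OF assms] by blast
  define F where "F = {e \<in> E. 0 < y e \<and> y e < 1}"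
  define I where "I = {e \<in> E. y e = 1}"
  define d where "d = (\<lambda>v. \<Sum>e\<in>{e \<in> E. v \<in> e}. y e)"
  have y01: "0 \<le> y e" "y e \<le> 1" if "e \<in> E" for e
    using y(1) that by (auto simp: fractional_2_matching_def)
  have fin: "finite F" "finite I" using E by (auto simp: F_def I_def)
  have F: "card {e \<in> F. v \<in> e} = 0 \<or> card {e \<in> F. v \<in> e} = 2 \<and> d v = 2" if "v \<in> V" for v
  proof -
    have "{e \<in> F. v \<in> e} = {e \<in> E. 0 < y e \<and> y e < 1 \<and> v \<in> e}" by (auto simp: F_def)
    then show ?thesis using y(3)[OF that] by (simp add: d_def)
  qed
  have d: "d v = sum y {e \<in> F. v \<in> e} + real (card {e \<in> I. v \<in> e})" for v
  proof -
    have "d v = sum y ({e \<in> F. v \<in> e} \<union> {e \<in> I. v \<in> e})"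
      unfolding d_def
    proof (rule sum.mono_neutral_right)
      show "\<forall>e\<in>{e \<in> E. v \<in> e} - ({e \<in> F. v \<in> e} \<union> {e \<in> I. v \<in> e}). y e = 0"
        using y01 by (force simp: F_def I_def)
    qed (use E in \<open>auto simp: F_def I_def\<close>)
    also have "\<dots> = sum y {e \<in> F. v \<in> e} + sum y {e \<in> I. v \<in> e}"
      by (rule sum.union_disjoint) (use E(1) in \<open>auto simp: F_def I_def\<close>)
    also have "sum y {e \<in> I. v \<in> e} = real (card {e \<in> I. v \<in> e})"
      by (simp add: I_def)
    finally show ?thesis .
  qed
  have dF: "d v = real (card {e \<in> I. v \<in> e})" if "v \<notin> \<Union>F" for v
  proof -
    have "{e \<in> F. v \<in> e} = {}" using that by auto
    then show ?thesis using d[of v] by (simp del: Collect_empty_eq)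
  qed
  have d2: "d v \<le> 2" if "v \<in> V" for v
    using y(1) that by (auto simp: fractional_2_matching_def d_def)
  show thesis
  proof (rule that)
    show "I \<subseteq> E" "F \<subseteq> E" "I \<inter> F = {}" by (auto simp: I_def F_def)
    show "\<forall>v\<in>V. card {e \<in> F. v \<in> e} = 0 \<and> card {e \<in> I. v \<in> e} \<le> 2 \<or>
        card {e \<in> F. v \<in> e} = 2 \<and> card {e \<in> I. v \<in> e} = 1"
    proof
      fix v assume v: "v \<in> V"
      show "card {e \<in> F. v \<in> e} = 0 \<and> card {e \<in> I. v \<in> e} \<le> 2 \<or>
        card {e \<in> F. v \<in> e} = 2 \<and> card {e \<in> I. v \<in> e} = 1"
      proof (cases "card {e \<in> F. v \<in> e} = 0")
        case True
        then have "v \<notin> \<Union>F" using fin by auto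
        from dF[OF this] d2[OF v] have "card {e \<in> I. v \<in> e} \<le> 2" by linarith
        then show ?thesis using True by blast
      next
        case False
        then have 2: "card {e \<in> F. v \<in> e} = 2" "d v = 2" using F[OF v] by auto
        from 2(1) obtain f g where fg: "{e \<in> F. v \<in> e} = {f, g}" "f \<noteq> g"
          by (auto simp: card_2_iff)
        then have "f \<in> F" "g \<in> F" by blast+
        then have "0 < y f + y g" "y f + y g < 2" by (auto simp: F_def)
        moreover have "y f + y g + real (card {e \<in> I. v \<in> e}) = 2"
          using d[of v] 2(2) fg by simp
        ultimately have "real (card {e \<in> I. v \<in> e}) < 2" "real (card {e \<in> I. v \<in> e}) > 0"
          by linarith+
        then have "card {e \<in> I. v \<in> e} < 2" "card {e \<in> I. v \<in> e} > 0" by simp_all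
        then have "card {e \<in> I. v \<in> e} = 1" by simp
        then show ?thesis using 2 by blast
      qed
    qed
  next
    have "(\<Sum>v\<in>V. 2 - d v) = 2 * real (card V) - (\<Sum>v\<in>V. d v)"
      by (simp add: sum_subtractf)
    also have "(\<Sum>v\<in>V. d v) = (\<Sum>e\<in>E. real (card (e \<inter> V)) * y e)"
      unfolding d_def by (rule sum_incidences[OF V E(1)])
    also have "\<dots> = (\<Sum>e\<in>E. 2 * y e)"
    proof (rule sum.cong[OF refl])
      fix e assume "e \<in> E"
      then have "e \<inter> V = e" "card e = 2" using E(2) by auto
      then show "real (card (e \<inter> V)) * y e = 2 * y e" by simp
    qed
    finally have total: "(\<Sum>v\<in>V. 2 - d v) = 2 * (real (card V) - sum y E)"
      by (simp add: sum_distrib_left)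
    have "(\<Sum>v\<in>V - \<Union>F. 2 - real (card {e \<in> I. v \<in> e})) = (\<Sum>v\<in>V - \<Union>F. 2 - d v)"
      by (rule sum.cong) (auto simp: dF)
    also have "\<dots> \<le> (\<Sum>v\<in>V. 2 - d v)"
      by (rule sum_mono2) (use V d2 in auto)
    also have "\<dots> \<le> 2 * (real (card V) - sum y0 E)"
      using y(2) total by simp
    finally show "(\<Sum>v\<in>V - \<Union>F. 2 - real (card {e \<in> I. v \<in> e})) \<le> 2 * (real (card V) - sum y0 E)" .
  qed
qed

subsection \<open>Path covers\<close>

definition hamiltonian_path :: "'a set set \<Rightarrow> 'a set \<Rightarrow> 'a list \<Rightarrow> bool" where
  "hamiltonian_path E S l \<longleftrightarrow>
     l \<noteq> [] \<and> distinct l \<and> set l = S \<and> successively (\<lambda>u v. {u, v} \<in> E) l"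

definition path_end :: "'a set set \<Rightarrow> 'a set \<Rightarrow> 'a \<Rightarrow> bool" where
  "path_end E S a \<longleftrightarrow> (\<exists>l. hamiltonian_path E S l \<and> hd l = a)"

text \<open>Only the vertex sets of the paths are recorded, so each part can be traversed anew
  whenever it is merged.\<close>

definition path_cover :: "'a set set \<Rightarrow> 'a set \<Rightarrow> 'a set set \<Rightarrow> bool" where
  "path_cover E V P \<longleftrightarrow> partition_on V P \<and> (\<forall>S\<in>P. \<exists>l. hamiltonian_path E S l)"

lemma card_1_unique:
  assumes "card {x \<in> A. Q x} = 1" "x \<in> A" "Q x" "y \<in> A" "Q y"
  shows "x = y"
  using assms by (metis (mono_tags, lifting) card_1_singletonE mem_Collect_eq singletonD)

lemma hamiltonian_path_rev: "hamiltonian_path E S l \<Longrightarrow> hamiltonian_path E S (rev l)"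
  by (simp add: hamiltonian_path_def insert_commute)

lemma path_end_hd: "hamiltonian_path E S l \<Longrightarrow> path_end E S (hd l)"
  by (auto simp: path_end_def)

lemma path_end_last: "hamiltonian_path E S l \<Longrightarrow> path_end E S (last l)"
  using path_end_hd[OF hamiltonian_path_rev, of E S l] by (simp add: hd_rev)

lemma path_end_in: "path_end E S a \<Longrightarrow> a \<in> S"
  by (auto simp: path_end_def hamiltonian_path_def)

lemma hamiltonian_path_append:
  assumes "hamiltonian_path E S l" "hamiltonian_path E T m" "S \<inter> T = {}" "{last l, hd m} \<in> E"
  shows "hamiltonian_path E (S \<union> T) (l @ m)"
  using assms by (auto simp: hamiltonian_path_def successively_append_iff)

lemma hamiltonian_path_card: "hamiltonian_path E S l \<Longrightarrow> length l = card S"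
  using distinct_card[of l] by (simp add: hamiltonian_path_def)

lemma hamiltonian_path_mono: "hamiltonian_path E S l \<Longrightarrow> E \<subseteq> E' \<Longrightarrow> hamiltonian_path E' S l"
  unfolding hamiltonian_path_def by (auto elim: successively_mono)

lemma path_cover_mono: "path_cover E V P \<Longrightarrow> E \<subseteq> E' \<Longrightarrow> path_cover E' V P"
  unfolding path_cover_def using hamiltonian_path_mono by blast

lemma path_cover_singletons: "path_cover E V ((\<lambda>v. {v}) ` V)"
proof -
  have "hamiltonian_path E {v} [v]" for v by (simp add: hamiltonian_path_def)
  then show ?thesis
    unfolding path_cover_def using partition_on_singletons[of V] by auto
qed

lemma path_cover_finite: "path_cover E V P \<Longrightarrow> finite V \<Longrightarrow> finite P"
  unfolding path_cover_def by (meson finite_elements)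

lemma path_cover_disjoint: "path_cover E V P \<Longrightarrow> S \<in> P \<Longrightarrow> T \<in> P \<Longrightarrow> S \<noteq> T \<Longrightarrow> S \<inter> T = {}"
  unfolding path_cover_def partition_on_def disjoint_def by blast

lemma path_cover_merge:
  assumes P: "path_cover E V P" and "S \<in> P" "T \<in> P" "S \<noteq> T"
    and "path_end E S a" "path_end E T b" "{a, b} \<in> E"
  shows "path_cover E V (insert (S \<union> T) (P - {S, T}))"
proof -
  have dis: "S \<inter> T = {}" using path_cover_disjoint assms by metis
  obtain l m where l: "hamiltonian_path E S l" "hd l = a" and m: "hamiltonian_path E T m" "hd m = b"
    using assms by (auto simp: path_end_def)
  have "last (rev l) = a" using l by (simp add: hamiltonian_path_def last_rev)
  then have "hamiltonian_path E (S \<union> T) (rev l @ m)"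
    using l m assms dis by (intro hamiltonian_path_append hamiltonian_path_rev) auto
  moreover have "partition_on V (insert (S \<union> T) (P - {S, T}))"
  proof (rule partition_onI)
    have "\<Union>P = V" "{} \<notin> P" using P by (auto simp: path_cover_def partition_on_def)
    then show "\<Union>(insert (S \<union> T) (P - {S, T})) = V"
      and "{} \<notin> insert (S \<union> T) (P - {S, T})"
      using assms(2,3) by auto
    have *: "A \<inter> B = {}" if "A \<in> P" "B \<in> P" "A \<noteq> B" for A B
      using path_cover_disjoint[OF P that] .
    have R: "(S \<union> T) \<inter> q = {}" if "q \<in> P - {S, T}" for q
      using *[of S q] *[of T q] assms(2,3) that by blast
    fix p q assume "p \<in> insert (S \<union> T) (P - {S, T})" "q \<in> insert (S \<union> T) (P - {S, T})" "p \<noteq> q"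
    then show "disjnt p q"
      using R[of p] R[of q] *[of p q] unfolding disjnt_def by blast
  qed
  ultimately show ?thesis
    using P unfolding path_cover_def by blast
qed

lemma card_merge_less:
  assumes "finite P" "S \<in> P" "T \<in> P" "S \<noteq> T"
  shows "card (insert (S \<union> T) (P - {S, T})) < card P"
proof -
  have "card {S, T} \<le> card P" using assms by (intro card_mono) auto
  moreover have "card (insert (S \<union> T) (P - {S, T})) \<le> Suc (card (P - {S, T}))"
    by (simp add: card_insert_le_m1 card_insert_if)
  moreover have "card (P - {S, T}) = card P - card {S, T}"
    using assms by (intro card_Diff_subset) auto
  ultimately show ?thesis using assms(4) by simp
qed

text \<open>If \<open>b\<close> were on another path \<open>T\<close>, it could not be an end of
  \<open>T\<close>, since merging would save a path. As an inner vertex it has two neighbours on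
  \<open>T\<close>, and the edge to \<open>a\<close> would be a third one.\<close>

lemma min_path_cover_end_neighbour:
  assumes V: "finite V" and E: "\<And>e. e \<in> E \<Longrightarrow> e \<subseteq> V \<and> card e = 2"
    and deg: "\<And>v. v \<in> V \<Longrightarrow> card {e \<in> E. v \<in> e} \<le> 2"
    and P: "path_cover E V P" and min: "\<And>Q. path_cover E V Q \<Longrightarrow> card P \<le> card Q"
    and S: "S \<in> P" "path_end E S a" "{a, b} \<in> E"
  shows "b \<in> S"
proof (rule ccontr)
  assume "b \<notin> S"
  have "b \<in> V" using E[OF S(3)] by auto
  then obtain T where T: "T \<in> P" "b \<in> T"
    using P unfolding path_cover_def partition_on_def by auto
  then have ne: "S \<noteq> T" using \<open>b \<notin> S\<close> by auto
  have "a \<notin> T"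
    using path_cover_disjoint[OF P S(1) T(1) ne] path_end_in[OF S(2)] by auto
  obtain m where m: "hamiltonian_path E T m"
    using P T unfolding path_cover_def by auto
  have "\<not> path_end E T b"
  proof
    assume "path_end E T b"
    then have "path_cover E V (insert (S \<union> T) (P - {S, T}))"
      using path_cover_merge P S T ne by metis
    from min[OF this] card_merge_less[OF path_cover_finite[OF P V] S(1) T(1) ne]
    show False by simp
  qed
  then have "b \<noteq> hd m" "b \<noteq> last m"
    using path_end_hd[OF m] path_end_last[OF m] by auto
  moreover obtain i where i: "i < length m" "m ! i = b"
    using T(2) m by (auto simp: hamiltonian_path_def in_set_conv_nth)
  moreover have "m \<noteq> []" using i by auto
  ultimately have "i \<noteq> 0" "i \<noteq> length m - 1"
    by (metis hd_conv_nth, metis last_conv_nth)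
  then have i0: "0 < i" "Suc i < length m" using i by linarith+
  define p q where "p = m ! (i - 1)" and "q = m ! Suc i"
  have edges: "{p, b} \<in> E" "{b, q} \<in> E"
    using m i i0 successively_nth[of "\<lambda>u v. {u, v} \<in> E" m "i - 1"]
      successively_nth[of "\<lambda>u v. {u, v} \<in> E" m i]
    by (auto simp: hamiltonian_path_def p_def q_def)
  have "p \<in> T" "q \<in> T" using m i0 by (auto simp: hamiltonian_path_def p_def q_def)
  moreover have "p \<noteq> q"
    using m i0 by (auto simp: hamiltonian_path_def p_def q_def nth_eq_iff_index_eq)
  ultimately have "card {{a, b}, {p, b}, {b, q}} = 3"
    using \<open>a \<notin> T\<close> by (auto simp: card_insert_if doubleton_eq_iff)
  moreover have "{{a, b}, {p, b}, {b, q}} \<subseteq> {e \<in> E. b \<in> e}"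
    using edges S(3) by auto
  moreover have "finite {e \<in> E. b \<in> e}"
    by (rule finite_subset[of _ "Pow V"]) (use E V in auto)
  ultimately have "3 \<le> card {e \<in> E. b \<in> e}" by (metis card_mono)
  then show False using deg[OF \<open>b \<in> V\<close>] by simp
qed

lemma min_path_cover_exists:
  assumes "path_cover E V P0" "Q P0"
  obtains P where "path_cover E V P" "Q P"
    "\<And>P'. path_cover E V P' \<Longrightarrow> Q P' \<Longrightarrow> card P \<le> card P'"
  using ex_has_least_nat[of "\<lambda>P. path_cover E V P \<and> Q P" P0 card] assms by blast

text \<open>Each path of a minimum cover by fractional edges is perfectly matched, or matched except
  for one of its ends; these exceptions are chosen so that no two of them are joined by an
  integral edge. Adding the integral edges gives a graph of maximum degree 2, so a minimum
  cover of it by paths cannot have a short path unless a vertex of small degree forces it.\<close>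

lemma path_cover_of_half_integral:
  assumes V: "finite V" and E: "finite E" "\<And>e. e \<in> E \<Longrightarrow> e \<subseteq> V \<and> card e = 2"
    and IF: "I \<subseteq> E" "F \<subseteq> E" "I \<inter> F = {}"
    and deg: "\<forall>v\<in>V. card {e \<in> F. v \<in> e} = 0 \<and> card {e \<in> I. v \<in> e} \<le> 2 \<or>
        card {e \<in> F. v \<in> e} = 2 \<and> card {e \<in> I. v \<in> e} = 1"
  obtains P where "path_cover E V P"
    "(\<Sum>S\<in>P. real (3 - card S)) \<le> (\<Sum>v\<in>V - \<Union>F. 2 - real (card {e \<in> I. v \<in> e}))"
proof -
  define T where "T = \<Union>F"
  have TV: "T \<subseteq> V" using IF(2) E(2) unfolding T_def by blast
  then have finT: "finite T" using V finite_subset by blast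
  have finF: "finite F" "finite I" using E(1) IF by (auto intro: finite_subset)
  have degT: "card {e \<in> F. v \<in> e} = 2" "card {e \<in> I. v \<in> e} = 1" if "v \<in> T" for v
  proof -
    have "card {e \<in> F. v \<in> e} \<noteq> 0" using that finF by (auto simp: T_def)
    then show "card {e \<in> F. v \<in> e} = 2" "card {e \<in> I. v \<in> e} = 1"
      using bspec[OF deg, of v] that TV by auto
  qed
  have F: "e \<subseteq> T \<and> card e = 2" if "e \<in> F" for e
    using that E IF by (auto simp: T_def)
  obtain P0 where P0: "path_cover F T P0" "\<And>Q. path_cover F T Q \<Longrightarrow> card P0 \<le> card Q"
    using min_path_cover_exists[OF path_cover_singletons, of "\<lambda>_. True"] by metis
  have nb0: "b \<in> S" if "S \<in> P0" "path_end F S a" "{a, b} \<in> F" for S a b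
    using min_path_cover_end_neighbour[OF finT F _ P0 that] degT by simp
  obtain l where l: "\<And>S. S \<in> P0 \<Longrightarrow> hamiltonian_path F S (l S)"
    using P0(1) unfolding path_cover_def by metis
  have unionP0: "\<Union>P0 = T" using P0(1) by (auto simp: path_cover_def partition_on_def)
  have len: "length (l S) \<ge> 2" if "S \<in> P0" for S
  proof (rule ccontr)
    assume "\<not> ?thesis"
    moreover have "l S \<noteq> []" using l[OF that] by (simp add: hamiltonian_path_def)
    ultimately obtain a where a: "l S = [a]"
      by (cases "l S") (auto simp: not_le less_Suc_eq)
    then have S: "S = {a}" using l[OF that] by (simp add: hamiltonian_path_def)
    then have "a \<in> T" using that unionP0 by auto
    then obtain e where e: "e \<in> F" "a \<in> e" by (auto simp: T_def)
    then obtain b where b: "e = {a, b}" "a \<noteq> b" using F[OF e(1)] by (auto simp: card_2_iff)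
    then have "b \<in> S" using nb0[OF that path_end_hd[OF l[OF that]], of b] a e by simp
    then show False using S b by simp
  qed
  \<comment> \<open>A path with an odd number of vertices has a matching that misses just one
    vertex, and this may be either of its two ends. The choice is made by \<open>f\<close>
    below.\<close>
  define K where "K = {S \<in> P0. odd (card S)}"
  define A where "A = (\<lambda>S. {hd (l S), last (l S)})"
  have A_sub: "A S \<subseteq> S" if "S \<in> P0" for S
    using path_end_in[OF path_end_hd] path_end_in[OF path_end_last] l[OF that]
    unfolding A_def by blast
  \<comment> \<open>Each vertex of \<open>T\<close> lies on exactly one edge of \<open>I\<close>, so
    it is related to at most one other vertex.\<close>
  define r where "r = (\<lambda>u v. u \<in> T \<and> v \<in> T \<and> {u, v} \<in> I)"
  have "\<exists>f. (\<forall>S\<in>K. f S \<in> A S) \<and> (\<forall>S\<in>K. \<forall>S'\<in>K. \<not> r (f S) (f S'))"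
  proof (rule independent_transversal)
    show "finite K" using path_cover_finite[OF P0(1) finT] by (simp add: K_def)
    show "disjoint_family_on A K"
      unfolding disjoint_family_on_def
    proof (intro ballI impI)
      fix S S' assume "S \<in> K" "S' \<in> K" "S \<noteq> S'"
      then have "S \<in> P0" "S' \<in> P0" "S \<inter> S' = {}"
        using path_cover_disjoint[OF P0(1)] by (simp_all add: K_def)
      then show "A S \<inter> A S' = {}" using A_sub[of S] A_sub[of S'] by blast
    qed
    show "card (A S) \<ge> 2" if "S \<in> K" for S
    proof -
      have S: "S \<in> P0" using that by (simp add: K_def)
      have "hd (l S) \<noteq> last (l S)"
        using len[OF S] l[OF S] nth_eq_iff_index_eq[of "l S" 0 "length (l S) - 1"]
        by (simp add: hamiltonian_path_def hd_conv_nth last_conv_nth)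
      then show ?thesis by (simp add: A_def)
    qed
    show "v = w" if "r u v" "r u w" for u v w
    proof -
      have "card {e \<in> I. u \<in> e} = 1" using that degT by (simp add: r_def)
      then have "{u, v} = {u, w}"
        by (rule card_1_unique) (use that in \<open>simp_all add: r_def\<close>)
      then show ?thesis by (auto simp: doubleton_eq_iff)
    qed
    show "\<not> r v v" for v using E(2)[of "{v}"] IF(1) by (auto simp: r_def)
  next
    fix u v show "r u v \<Longrightarrow> r v u" by (simp add: r_def insert_commute)
  qed (simp_all add: A_def)
  then obtain f where f: "\<And>S. S \<in> K \<Longrightarrow> f S \<in> A S" "\<And>S S'. S \<in> K \<Longrightarrow> S' \<in> K \<Longrightarrow> \<not> r (f S) (f S')"
    by blast
  have "\<exists>D\<subseteq>F. disjoint D \<and> \<Union>D = S - (if S \<in> K then {f S} else {})" if S: "S \<in> P0" for S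
  proof -
    have lS: "successively (\<lambda>u v. {u, v} \<in> F) (l S)" "distinct (l S)" "set (l S) = S" "l S \<noteq> []"
      using l[OF S] by (auto simp: hamiltonian_path_def)
    have cS: "length (l S) = card S" using hamiltonian_path_card l S by blast
    consider "S \<notin> K" | "S \<in> K" "f S = hd (l S)" | "S \<in> K" "f S = last (l S)"
      using f(1)[of S] by (auto simp: A_def)
    then show ?thesis
    proof cases
      case 1
      then show ?thesis using path_even_matching[OF lS(1,2)] cS lS(3) S by (simp add: K_def)
    next
      case 2
      have "successively (\<lambda>u v. {u, v} \<in> F) (tl (l S))" "distinct (tl (l S))"
        using lS by (cases "l S"; auto simp: successively_Cons)+
      moreover have "even (length (tl (l S)))" using 2 cS lS(4) by (auto simp: K_def)
      moreover have "set (tl (l S)) = S - {hd (l S)}"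
        using lS by (cases "l S") auto
      ultimately show ?thesis using path_even_matching[of F "tl (l S)"] 2 by simp
    next
      case 3
      have *: "l S = butlast (l S) @ [last (l S)]" using lS(4) by simp
      have "successively (\<lambda>u v. {u, v} \<in> F) (butlast (l S))" "distinct (butlast (l S))"
        using lS * by (metis successively_append_iff) (simp add: lS distinct_butlast)
      moreover have "even (length (butlast (l S)))" using 3 cS lS(4) by (auto simp: K_def)
      moreover have "set (butlast (l S)) = S - {last (l S)}"
      proof -
        have "S = set (butlast (l S) @ [last (l S)])" "distinct (butlast (l S) @ [last (l S)])"
          using * lS by simp_all
        then show ?thesis by auto
      qed
      ultimately show ?thesis using path_even_matching[of F "butlast (l S)"] 3 by simp
    qed
  qed
  then obtain D0 where D0: "\<And>S. S \<in> P0 \<Longrightarrow> D0 S \<subseteq> F" "\<And>S. S \<in> P0 \<Longrightarrow> disjoint (D0 S)"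
    "\<And>S. S \<in> P0 \<Longrightarrow> \<Union>(D0 S) = S - (if S \<in> K then {f S} else {})"
    by metis
  define D where "D = (\<Union>S\<in>P0. D0 S)"
  have DF: "D \<subseteq> F" using D0(1) by (auto simp: D_def)
  have disD: "d = d'" if d: "d \<in> D" "d' \<in> D" "v \<in> d" "v \<in> d'" for d d' v
  proof -
    obtain S S' where S: "S \<in> P0" "d \<in> D0 S" "S' \<in> P0" "d' \<in> D0 S'" using d by (auto simp: D_def)
    have "v \<in> S" "v \<in> S'" using D0(3)[OF S(1)] D0(3)[OF S(3)] S(2,4) d(3,4) by blast+
    then have "S = S'" using path_cover_disjoint[OF P0(1) S(1,3)] by blast
    then show ?thesis using D0(2)[OF S(1)] S d unfolding disjoint_def by blast
  qed
  have uncovered: "\<exists>S\<in>K. v = f S" if v: "v \<in> T" "v \<notin> \<Union>D" for v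
  proof -
    obtain S where S: "S \<in> P0" "v \<in> S" using v unionP0 by auto
    then have "v \<notin> \<Union>(D0 S)" using v by (auto simp: D_def)
    then show ?thesis using D0(3)[OF S(1)] S(2) by (cases "S \<in> K") auto
  qed
  \<comment> \<open>A vertex of \<open>T\<close> has one edge in \<open>I\<close> and at most one in
    the matching \<open>D\<close>; the other vertices meet only \<open>I\<close>. So the maximum
    degree is 2.\<close>
  define M where "M = I \<union> D"
  have ME: "M \<subseteq> E" using IF DF by (auto simp: M_def)
  have M: "e \<subseteq> V \<and> card e = 2" if "e \<in> M" for e using that ME E by auto
  have degM: "card {e \<in> M. v \<in> e} \<le> 2" if v: "v \<in> V" for v
  proof (cases "v \<in> T")
    case True
    have "finite D" using finF(1) DF by (rule finite_subset[rotated])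
    then have "finite {e \<in> D. v \<in> e}" by simp
    then have "card {e \<in> D. v \<in> e} \<le> 1"
      using card_le_Suc0_iff_eq[of "{e \<in> D. v \<in> e}"] disD by (metis (no_types, lifting) One_nat_def mem_Collect_eq)
    moreover have "{e \<in> M. v \<in> e} = {e \<in> I. v \<in> e} \<union> {e \<in> D. v \<in> e}" by (auto simp: M_def)
    ultimately show ?thesis
      using degT(2)[OF True] card_Un_le[of "{e \<in> I. v \<in> e}" "{e \<in> D. v \<in> e}"] by simp
  next
    case False
    then have *: "{e \<in> M. v \<in> e} = {e \<in> I. v \<in> e}" using DF by (auto simp: M_def T_def)
    show ?thesis unfolding * using bspec[OF deg v] by linarith
  qed
  obtain P where P: "path_cover M V P" "\<And>Q. path_cover M V Q \<Longrightarrow> card P \<le> card Q"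
    using min_path_cover_exists[OF path_cover_singletons, of "\<lambda>_. True"] by metis
  have nb: "e \<subseteq> S" if S: "S \<in> P" "path_end M S a" and e: "e \<in> M" "a \<in> e" for S a e
  proof -
    obtain x y where "e = {x, y}" using M[OF e(1)] by (auto simp: card_2_iff)
    then obtain b where b: "e = {a, b}" using e(2) by blast
    then have "b \<in> S"
      using min_path_cover_end_neighbour[OF V M degM P S] e by simp
    then show ?thesis using b path_end_in[OF S(2)] by simp
  qed
  define w where "w = (\<lambda>v. 2 - real (card {e \<in> I. v \<in> e}))"
  have w0: "w v \<ge> 0" if "v \<in> V" for v using bspec[OF deg that] by (auto simp: w_def)
  have SV: "S \<subseteq> V" if "S \<in> P" for S
    using P(1) that by (auto simp: path_cover_def partition_on_def)
  then have finS: "finite S" if "S \<in> P" for S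
    using that V finite_subset by blast
  have short: "real (3 - card S) \<le> sum w (S - T)" if S: "S \<in> P" for S
  proof -
    obtain m where m: "hamiltonian_path M S m" using P(1) S by (auto simp: path_cover_def)
    have cm: "card S = length m" "S = set m" "m \<noteq> []"
      using hamiltonian_path_card[OF m] m by (auto simp: hamiltonian_path_def)
    have nonneg: "0 \<le> sum w B" if "B \<subseteq> S" for B
      by (rule sum_nonneg) (use w0 SV[OF S] that in blast)
    consider a where "m = [a]" | a b where "m = [a, b]" | "length m \<ge> 3"
      using cm(3) by (cases m; cases "tl m"; cases "tl (tl m)") auto
    then show ?thesis
    proof cases
      case 1
      then have Sa: "S = {a}" using cm by simp
      have none: "{e \<in> I. a \<in> e} = {}"
      proof (rule ccontr)
        assume "{e \<in> I. a \<in> e} \<noteq> {}"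
        then obtain e where e: "e \<in> M" "a \<in> e" by (auto simp: M_def)
        then have "e \<subseteq> {a}" using nb[OF S path_end_hd[OF m]] 1 Sa by simp
        then show False using M[OF e(1)] card_mono[of "{a}" e] by simp
      qed
      then have "a \<notin> T" using degT(2)[of a] by (auto simp del: Collect_empty_eq)
      then have "S - T = {a}" using Sa by blast
      then have "sum w (S - T) = w a" by simp
      then show ?thesis using none by (simp add: w_def Sa del: Collect_empty_eq)
    next
      case 2
      then have Sab: "S = {a, b}" using cm by simp
      have ab: "a \<noteq> b" using m 2 by (auto simp: hamiltonian_path_def)
      have ends: "path_end M S a" "path_end M S b"
        using path_end_hd[OF m] path_end_last[OF m] 2 by auto
      have only: "e = {a, b}" if "e \<in> M" "a \<in> e \<or> b \<in> e" for e
      proof -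
        have "e \<subseteq> {a, b}" using nb[OF S] ends that Sab by metis
        then show ?thesis using M[OF that(1)] ab card_subset_eq[of "{a, b}" e] by simp
      qed
      have one: "1 \<le> w v" if "v \<in> S" for v
      proof -
        have "{e \<in> I. v \<in> e} \<subseteq> {{a, b}}" using only that Sab by (auto simp: M_def)
        then have "card {e \<in> I. v \<in> e} \<le> card {{a, b}}" by (rule card_mono[rotated]) simp
        then show ?thesis by (simp add: w_def)
      qed
      \<comment> \<open>If both vertices were in \<open>T\<close>, their \<open>I\<close>-edge would
        be \<open>{a, b}\<close>. A \<open>D\<close>-edge at either of them would be
        \<open>{a, b}\<close> as well, which is impossible because \<open>I\<close> and
        \<open>F\<close> are disjoint. So \<open>a\<close> and \<open>b\<close> would both be
        exceptional vertices chosen by \<open>f\<close>, yet joined by an edge of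
        \<open>I\<close>.\<close>
      have "\<not> S \<subseteq> T"
      proof
        assume "S \<subseteq> T"
        have free: "v \<notin> \<Union>D \<and> {a, b} \<in> I" if "v \<in> S" for v
        proof -
          have "card {e \<in> I. v \<in> e} = 1" using degT \<open>S \<subseteq> T\<close> that by auto
          then have "{e \<in> I. v \<in> e} \<noteq> {}" by force
          then obtain e where e: "e \<in> I" "v \<in> e" by blast
          then have "e = {a, b}" using only[of e] that Sab by (auto simp: M_def)
          then have I: "{a, b} \<in> I" using e by simp
          have "d = {a, b}" if "d \<in> D" "v \<in> d" for d
            using only[of d] that \<open>v \<in> S\<close> Sab by (auto simp: M_def)
          then show ?thesis using I DF IF(3) by blast
        qed
        obtain S1 S2 where "S1 \<in> K" "a = f S1" "S2 \<in> K" "b = f S2"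
          using uncovered[of a] uncovered[of b] free \<open>S \<subseteq> T\<close> Sab by auto
        moreover have "r a b" using free[of a] \<open>S \<subseteq> T\<close> Sab by (auto simp: r_def)
        ultimately show False using f(2) by blast
      qed
      then obtain v where v: "v \<in> S" "v \<notin> T" by auto
      have "1 \<le> w v" using one v by blast
      also have "w v = sum w {v}" by simp
      also have "\<dots> \<le> sum w (S - T)"
        by (rule sum_mono2) (use v SV[OF S] finS[OF S] w0 in auto)
      finally show ?thesis using cm(1) 2 by simp
    next
      case 3
      then show ?thesis using nonneg[of "S - T"] cm(1) by simp
    qed
  qed
  have "(\<Sum>S\<in>P. real (3 - card S)) \<le> (\<Sum>S\<in>P. sum w (S - T))"
    by (rule sum_mono) (rule short)
  also have "\<dots> = sum w (\<Union>S\<in>P. S - T)"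
    using path_cover_disjoint[OF P(1)] path_cover_finite[OF P(1) V] finS
    by (intro sum.UNION_disjoint[symmetric]) blast+
  also have "(\<Union>S\<in>P. S - T) = V - T"
    using P(1) by (auto simp: path_cover_def partition_on_def)
  finally show thesis
    using path_cover_mono[OF P(1) ME] by (intro that) (simp_all add: w_def T_def)
qed

subsection \<open>The subtour LP and unmergeable path covers\<close>

lemma finite_complete_edges: "finite V \<Longrightarrow> finite (complete_edges V)"
  by (rule finite_subset[of _ "Pow V"]) (auto simp: complete_edges_def)

lemma complete_edges_card_2: "card S = 2 \<Longrightarrow> complete_edges S = {S}"
  using card_subset_eq[OF card_ge_0_finite, of S] by (auto simp: complete_edges_def)

lemma cut_singleton: "cut V {v} = {e \<in> complete_edges V. v \<in> e}"
proof -
  have "card (e \<inter> {v}) = 1 \<longleftrightarrow> v \<in> e" for e :: "'a set"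
    by (cases "v \<in> e") auto
  then show ?thesis by (simp add: cut_def)
qed

lemma cut_complement:
  assumes "finite V" "S \<subseteq> V"
  shows "cut V (V - S) = cut V S"
proof -
  have "card (e \<inter> (V - S)) = 1 \<longleftrightarrow> card (e \<inter> S) = 1" if "e \<in> complete_edges V" for e
  proof -
    have e: "e \<subseteq> V" "card e = 2" using that by (auto simp: complete_edges_def)
    then have "finite e" using assms finite_subset by blast
    then have "card e = card (e \<inter> S) + card (e - S)"
      by (metis Diff_disjoint Int_Diff_Un card_Un_disjoint finite_Diff finite_Int inf_assoc inf_bot_right)
    moreover have "e \<inter> (V - S) = e - S" using e by auto
    ultimately show ?thesis using e by auto
  qed
  then show ?thesis by (auto simp: cut_def)
qed

text \<open>An edge inside \<open>S\<close> is counted at both endpoints, an edge of the cut at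
  one.\<close>

lemma sum_degrees:
  assumes "finite V" "S \<subseteq> V"
  shows "(\<Sum>v\<in>S. \<Sum>e\<in>cut V {v}. x e) =
    (\<Sum>e\<in>cut V S. x e) + 2 * (\<Sum>e\<in>complete_edges S. x e :: real)"
proof -
  have fin: "finite S" "finite (complete_edges V)"
    using assms finite_subset finite_complete_edges by auto
  have "(\<Sum>v\<in>S. \<Sum>e\<in>cut V {v}. x e) = (\<Sum>e\<in>complete_edges V. real (card (e \<inter> S)) * x e)"
    unfolding cut_singleton by (rule sum_incidences[OF fin])
  also have "\<dots> = (\<Sum>e\<in>complete_edges V.
      (if card (e \<inter> S) = 1 then x e else 0) + (if e \<subseteq> S then 2 * x e else 0))"
  proof (rule sum.cong[OF refl])
    fix e assume "e \<in> complete_edges V"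
    then have e: "card e = 2" "finite e" using assms(1) finite_subset by (auto simp: complete_edges_def)
    then have le: "card (e \<inter> S) \<le> 2" by (metis card_mono inf_le1)
    have eq: "card (e \<inter> S) = 2 \<longleftrightarrow> e \<subseteq> S"
      using e by (metis card_subset_eq inf.absorb1 inf_le1 inf.cobounded2)
    have "card (e \<inter> S) = 0 \<or> card (e \<inter> S) = 1 \<or> card (e \<inter> S) = 2" using le by linarith
    then show "real (card (e \<inter> S)) * x e =
        (if card (e \<inter> S) = 1 then x e else 0) + (if e \<subseteq> S then 2 * x e else 0)"
      unfolding eq[symmetric] by (elim disjE) simp_all
  qed
  also have "\<dots> = (\<Sum>e\<in>complete_edges V. if card (e \<inter> S) = 1 then x e else 0)
      + (\<Sum>e\<in>complete_edges V. if e \<subseteq> S then 2 * x e else 0)"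
    by (rule sum.distrib)
  also have "(\<Sum>e\<in>complete_edges V. if card (e \<inter> S) = 1 then x e else 0) = (\<Sum>e\<in>cut V S. x e)"
    unfolding cut_def by (rule sum.inter_filter[OF fin(2), symmetric])
  also have "(\<Sum>e\<in>complete_edges V. if e \<subseteq> S then 2 * x e else 0)
      = (\<Sum>e\<in>{e \<in> complete_edges V. e \<subseteq> S}. 2 * x e)"
    by (rule sum.inter_filter[OF fin(2), symmetric])
  also have "{e \<in> complete_edges V. e \<subseteq> S} = complete_edges S"
    using assms(2) by (auto simp: complete_edges_def)
  finally show ?thesis by (simp add: sum_distrib_left)
qed

lemma subtour_degree: "subtour_feasible V x \<Longrightarrow> v \<in> V \<Longrightarrow> (\<Sum>e\<in>cut V {v}. x e) = 2"
  by (simp add: subtour_feasible_def)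

lemma subtour_bounds:
  "subtour_feasible V x \<Longrightarrow> e \<in> complete_edges V \<Longrightarrow> 0 \<le> x e"
  "subtour_feasible V x \<Longrightarrow> e \<in> complete_edges V \<Longrightarrow> x e \<le> 1"
  by (simp_all add: subtour_feasible_def)

lemma subtour_total:
  assumes "finite V" "subtour_feasible V x"
  shows "(\<Sum>e\<in>complete_edges V. x e) = real (card V)"
proof -
  have "cut V V = {}"
    by (auto simp: cut_def complete_edges_def Int_absorb2)
  then show ?thesis
    using sum_degrees[OF assms(1) order_refl, of x] subtour_degree[OF assms(2)] by simp
qed

text \<open>For \<open>card V \<le> 5\<close> the cut constraint of a triangle is not listed in the LP, but it follows
  from the degree constraints on the complement.\<close>

lemma subtour_triangle:
  assumes V: "finite V" and x: "subtour_feasible V x" and S: "S \<subset> V" "card S = 3"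
  shows "(\<Sum>e\<in>complete_edges S. x e) \<le> 2"
proof -
  have SV: "S \<subseteq> V" using S by auto
  have "(\<Sum>v\<in>S. \<Sum>e\<in>cut V {v}. x e) = 2 * 3"
    using subtour_degree[OF x] SV S(2) by (simp add: subset_iff)
  then have sum: "6 = (\<Sum>e\<in>cut V S. x e) + 2 * (\<Sum>e\<in>complete_edges S. x e)"
    using sum_degrees[OF V SV, of x] by simp
  define R where "R = V - S"
  have R: "R \<subseteq> V" "cut V R = cut V S" using cut_complement[OF V SV] by (auto simp: R_def)
  have cV: "card V = card R + 3"
    using card_Diff_subset[of S V] finite_subset[OF SV V] SV S card_mono[OF V SV] by (simp add: R_def)
  have "card R \<noteq> 0" using S V by (auto simp: R_def)
  then consider "card R = 1" | "card R = 2" | "card R \<ge> 3" by linarith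
  then have "(\<Sum>e\<in>cut V S. x e) \<ge> 2"
  proof cases
    case 1
    then obtain r where r: "R = {r}" by (rule card_1_singletonE)
    then have "r \<in> V" using R(1) by simp
    then show ?thesis using subtour_degree[OF x, of r] R(2) r by simp
  next
    case 2
    have "(\<Sum>v\<in>R. \<Sum>e\<in>cut V {v}. x e) = 2 * 2"
      using subtour_degree[OF x] R(1) 2 by (simp add: subset_iff)
    then have "4 = (\<Sum>e\<in>cut V R. x e) + 2 * x R"
      using sum_degrees[OF V R(1), of x] complete_edges_card_2[OF 2] by simp
    moreover have "x R \<le> 1"
      using subtour_bounds(2)[OF x] R(1) 2 by (simp add: complete_edges_def)
    ultimately show ?thesis using R(2) by simp
  next
    case 3
    then show ?thesis using x S cV by (simp add: subtour_feasible_def)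
  qed
  then show ?thesis using sum by linarith
qed

text \<open>Up to a factor 2, the right-hand side is the LP weight that has to leave \<open>A\<close>, minus the degree
  capacity of the remaining vertices of \<open>S\<close>.\<close>

lemma path_ends_surplus:
  assumes V: "finite V" and x: "subtour_feasible V x" and E: "E \<subseteq> complete_edges V"
    and l: "hamiltonian_path E S l" and S: "S \<subset> V"
  obtains A where "A \<subseteq> S" "\<forall>a\<in>A. path_end E S a"
    "(if card S \<le> 3 then 1 else 3 - real (card S)) \<le>
      real (card A) - (\<Sum>e\<in>{e \<in> E. e \<subseteq> A}. x e) - real (card (S - A))"
proof -
  have l': "l \<noteq> []" "distinct l" "set l = S" "length l = card S"
    using l hamiltonian_path_card[OF l] by (auto simp: hamiltonian_path_def)
  have finS: "finite S" using l'(3) by auto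
  have ends: "path_end E S (hd l)" "path_end E S (last l)"
    using path_end_hd[OF l] path_end_last[OF l] .
  have finE: "finite E" using E finite_complete_edges[OF V] finite_subset by blast
  have sub: "(\<Sum>e\<in>{e \<in> E. e \<subseteq> A}. x e) \<le> (\<Sum>e\<in>complete_edges A. x e)" if "A \<subseteq> V" for A
  proof (rule sum_mono2)
    show "finite (complete_edges A)" using that V finite_subset finite_complete_edges by blast
    show "{e \<in> E. e \<subseteq> A} \<subseteq> complete_edges A" using E by (auto simp: complete_edges_def)
    show "0 \<le> x e" if "e \<in> complete_edges A - {e \<in> E. e \<subseteq> A}" for e
      using that \<open>A \<subseteq> V\<close> subtour_bounds(1)[OF x, of e] by (auto simp: complete_edges_def)
  qed
  have two: "(\<Sum>e\<in>{e \<in> E. e \<subseteq> A}. x e) \<le> 1" if "A \<subseteq> V" "card A = 2" for A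
    using sub[OF that(1)] complete_edges_card_2[OF that(2)] subtour_bounds(2)[OF x, of A] that
    by (simp add: complete_edges_def)
  have none: "(\<Sum>e\<in>{e \<in> E. e \<subseteq> A}. x e) = 0" if "A \<notin> E" "card A \<le> 2" "finite A" for A
  proof -
    have "e = A" if "e \<in> E" "e \<subseteq> A" for e
      using that E \<open>card A \<le> 2\<close> \<open>finite A\<close> card_seteq[of A e] by (auto simp: complete_edges_def)
    then have "{e \<in> E. e \<subseteq> A} = {}" using that(1) by blast
    then show ?thesis by (simp only: sum.empty)
  qed
  \<comment> \<open>The right-hand side is at least \<open>1 - 0 - 0\<close> for one vertex,
    \<open>2 - 1 - 0\<close> for two, and \<open>2 - 1 - (s - 2) = 3 - s\<close> for
    \<open>s \<ge> 4\<close> with \<open>A\<close> the two ends of \<open>l\<close>.\<close>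
  have "card S \<noteq> 0" using l'(1,4) by (metis length_0_conv)
  then consider "card S = 1" | "card S = 2" | "card S = 3" | "card S \<ge> 4" by linarith
  then show thesis
  proof cases
    case 1
    then obtain a where a: "l = [a]" using l' by (auto simp: length_Suc_conv)
    then have Sa: "S = {a}" using l' by simp
    have "S \<notin> E" using E 1 by (auto simp: complete_edges_def)
    then have "(\<Sum>e\<in>{e \<in> E. e \<subseteq> S}. x e) = 0" using none 1 finS by simp
    moreover have "path_end E S v" if "v \<in> S" for v
      using that ends(1) a Sa by simp
    ultimately show ?thesis using 1 by (intro that[of S]) simp_all
  next
    case 2
    then obtain a b where a: "l = [a, b]" using l' by (auto simp: length_Suc_conv numeral_2_eq_2)
    then have "S = {a, b}" using l' by simp
    then have "path_end E S v" if "v \<in> S" for v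
      using that ends a by auto
    moreover have "(\<Sum>e\<in>{e \<in> E. e \<subseteq> S}. x e) \<le> 1" using two[of S] 2 S by blast
    ultimately show ?thesis using 2 by (intro that[of S]) simp_all
  next
    case 3
    then obtain a b c where a: "l = [a, b, c]" using l' by (auto simp: length_Suc_conv numeral_3_eq_3)
    then have Sa: "S = {a, b, c}" and dis: "a \<noteq> b" "a \<noteq> c" "b \<noteq> c" using l' by auto
    \<comment> \<open>For three vertices there are two choices of \<open>A\<close>. If the ends of
      \<open>l\<close> are adjacent, all three vertices are ends and the triangle bound gives
      \<open>3 - 2 - 0\<close>; otherwise \<open>A = {a, c}\<close> contains no edge of
      \<open>E\<close> and gives \<open>2 - 0 - 1\<close>.\<close>
    show ?thesis
    proof (cases "{a, c} \<in> E")
      case True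
      have "hamiltonian_path E S [b, c, a]"
        using l a True Sa by (auto simp: hamiltonian_path_def insert_commute)
      from path_end_hd[OF this] have "path_end E S b" by simp
      then have "path_end E S v" if "v \<in> S" for v
        using that ends a Sa by auto
      moreover have "(\<Sum>e\<in>{e \<in> E. e \<subseteq> S}. x e) \<le> 2"
        using sub[OF psubset_imp_subset[OF S]] subtour_triangle[OF V x S 3] by simp
      ultimately show ?thesis using 3 by (intro that[of S]) simp_all
    next
      case False
      have "card {a, c} = 2" "S - {a, c} = {b}" "{a, c} \<subseteq> S" using dis Sa by auto
      moreover have "(\<Sum>e\<in>{e \<in> E. e \<subseteq> {a, c}}. x e) = 0"
        using none[OF False] dis by simp
      moreover have "path_end E S v" if "v \<in> {a, c}" for v
        using that ends a by auto
      ultimately show ?thesis using 3 by (intro that[of "{a, c}"]) simp_all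
    qed
  next
    case 4
    define A where "A = {hd l, last l}"
    have "hd l \<noteq> last l"
      using l' 4 nth_eq_iff_index_eq[of l 0 "length l - 1"]
      by (simp add: hd_conv_nth last_conv_nth)
    then have A: "card A = 2" "A \<subseteq> S" using l' by (auto simp: A_def)
    then have "card (S - A) = card S - 2" using finS by (simp add: card_Diff_subset finite_subset)
    then have "real (card (S - A)) = real (card S) - 2" using 4 by simp
    moreover have "(\<Sum>e\<in>{e \<in> E. e \<subseteq> A}. x e) \<le> 1" using two[of A] A S by auto
    moreover have "path_end E S v" if "v \<in> A" for v
      using that ends by (auto simp: A_def)
    ultimately show ?thesis
      using A 4 by (intro that[of A]) simp_all
  qed
qed

text \<open>Let \<open>Z\<close> be the union of the end sets \<open>A S\<close>, with total degree
  \<open>2 * card Z\<close>. An \<open>E\<close>-edge inside \<open>Z\<close> lies within a single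
  \<open>A S\<close>, because ends of different paths are not adjacent. Every other edge at
  \<open>Z\<close> either uses degree of \<open>V - Z\<close>, of which there is
  \<open>2 * card (V - Z)\<close>, or lies outside \<open>E\<close>.\<close>

lemma unmergeable_cover_surplus:
  assumes V: "finite V" and x: "subtour_feasible V x" and E: "E \<subseteq> complete_edges V"
    and P: "path_cover E V P" "V \<notin> P"
    and ends: "\<And>S T a b. S \<in> P \<Longrightarrow> T \<in> P \<Longrightarrow> S \<noteq> T \<Longrightarrow>
      path_end E S a \<Longrightarrow> path_end E T b \<Longrightarrow> {a, b} \<notin> E"
  shows "(\<Sum>S\<in>P. if card S \<le> 3 then 1 else 3 - real (card S)) \<le> (\<Sum>e\<in>complete_edges V - E. x e)"
proof -
  define g where "g = (\<lambda>S::'a set. if card S \<le> 3 then 1 else 3 - real (card S))"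
  have union: "\<Union>P = V" using P by (auto simp: path_cover_def partition_on_def)
  have finP: "finite P" using path_cover_finite[OF P(1) V] .
  have fin: "finite (complete_edges V)" "finite E"
    using finite_complete_edges[OF V] E finite_subset by auto
  have x0: "0 \<le> x e" if "e \<in> complete_edges V" for e using subtour_bounds(1)[OF x that] .
  have ex: "\<exists>A. A \<subseteq> S \<and> (\<forall>a\<in>A. path_end E S a) \<and>
      g S \<le> real (card A) - (\<Sum>e\<in>{e \<in> E. e \<subseteq> A}. x e) - real (card (S - A))" if "S \<in> P" for S
  proof -
    have "S \<subseteq> V" using Union_upper[OF that] union by simp
    moreover have "S \<noteq> V" using that P(2) by blast
    ultimately have SV: "S \<subset> V" by (rule psubsetI)
    have "\<exists>l. hamiltonian_path E S l" using that P(1) by (simp add: path_cover_def)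
    then obtain l where l: "hamiltonian_path E S l" ..
    obtain A where A: "A \<subseteq> S" "\<forall>a\<in>A. path_end E S a"
      "(if card S \<le> 3 then 1 else 3 - real (card S)) \<le>
        real (card A) - (\<Sum>e\<in>{e \<in> E. e \<subseteq> A}. x e) - real (card (S - A))"
      by (rule path_ends_surplus[OF V x E l SV]) (rule that)
    then show ?thesis unfolding g_def by (intro exI[of _ A] conjI)
  qed
  from bchoice[OF ballI, OF ex] obtain A where A': "\<forall>S\<in>P. A S \<subseteq> S \<and> (\<forall>a\<in>A S. path_end E S a) \<and>
      g S \<le> real (card (A S)) - (\<Sum>e\<in>{e \<in> E. e \<subseteq> A S}. x e) - real (card (S - A S))"
    by (rule exE)
  have A: "S \<in> P \<Longrightarrow> A S \<subseteq> S"
    "\<And>a. S \<in> P \<Longrightarrow> a \<in> A S \<Longrightarrow> path_end E S a"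
    "S \<in> P \<Longrightarrow> g S \<le> real (card (A S)) - (\<Sum>e\<in>{e \<in> E. e \<subseteq> A S}. x e) - real (card (S - A S))"
    for S
    using A' by simp_all
  define Z where "Z = (\<Union>S\<in>P. A S)"
  have ZV: "Z \<subseteq> V" using A(1) union by (auto simp: Z_def)
  have finS: "finite S" if "S \<in> P" for S
    using finite_subset[OF Union_upper[OF that]] union V by simp
  have finA: "finite (A S)" if "S \<in> P" for S
    using finite_subset[OF A(1)[OF that] finS[OF that]] .
  have disP: "S \<inter> T = {}" if "S \<in> P" "T \<in> P" "S \<noteq> T" for S T
    using path_cover_disjoint[OF P(1) that] .
  have disA: "A S \<inter> A T = {}" if "S \<in> P" "T \<in> P" "S \<noteq> T" for S T
    using disP[OF that] A(1)[OF that(1)] A(1)[OF that(2)] by blast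
  have cZ: "card Z = (\<Sum>S\<in>P. card (A S))"
    unfolding Z_def using finP disA finA by (intro card_UN_disjoint) simp_all
  have VZ: "V - Z = (\<Union>S\<in>P. S - A S)"
  proof (intro equalityI subsetI)
    fix v assume "v \<in> V - Z"
    then show "v \<in> (\<Union>S\<in>P. S - A S)" using union by (auto simp: Z_def)
  next
    fix v assume "v \<in> (\<Union>S\<in>P. S - A S)"
    then obtain S where S: "S \<in> P" "v \<in> S" "v \<notin> A S" by blast
    have "v \<notin> A T" if "T \<in> P" for T
      using S disP[OF S(1) that] A(1)[OF that] by blast
    then show "v \<in> V - Z" using S union by (auto simp: Z_def)
  qed
  have cVZ: "card (V - Z) = (\<Sum>S\<in>P. card (S - A S))"
  proof (unfold VZ, rule card_UN_disjoint)
    show "\<forall>S\<in>P. \<forall>T\<in>P. S \<noteq> T \<longrightarrow> (S - A S) \<inter> (T - A T) = {}" using disP by blast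
  qed (use finP finS in simp_all)
  have deg: "(\<Sum>e\<in>complete_edges V. real (card (e \<inter> W)) * x e) = 2 * real (card W)" if "W \<subseteq> V" for W
  proof -
    have "finite W" using that V finite_subset by blast
    then have "(\<Sum>e\<in>complete_edges V. real (card (e \<inter> W)) * x e) = (\<Sum>v\<in>W. \<Sum>e\<in>cut V {v}. x e)"
      unfolding cut_singleton by (rule sum_incidences[OF _ fin(1), symmetric])
    also have "\<dots> = (\<Sum>v\<in>W. 2)" using subtour_degree[OF x] that by (intro sum.cong) auto
    finally show ?thesis by simp
  qed
  \<comment> \<open>The indicator of the \<open>E\<close>-edges within some \<open>A S\<close>,
    written as a sum over \<open>P\<close> so that the order of summation can be exchanged
    later.\<close>
  define inside where "inside = (\<lambda>e. \<Sum>S\<in>P. if e \<in> E \<and> e \<subseteq> A S then 1 else (0::real))"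
  have inside0: "inside e \<ge> 0" for e unfolding inside_def by (rule sum_nonneg) simp
  \<comment> \<open>The charge of one edge: twice if it lies within one \<open>A S\<close>, once per
    endpoint outside \<open>Z\<close>, and twice if it is not in \<open>E\<close>.\<close>
  have edge: "real (card (e \<inter> Z)) \<le> 2 * inside e + real (card (e \<inter> (V - Z))) + (if e \<in> E then 0 else 2)"
    if e: "e \<in> complete_edges V" for e
  proof -
    have e2: "e \<subseteq> V" "card e = 2" "finite e"
      using e V finite_subset by (auto simp: complete_edges_def)
    have split: "card (e \<inter> Z) + card (e \<inter> (V - Z)) = 2"
    proof -
      have "e = (e \<inter> Z) \<union> (e \<inter> (V - Z))" using e2 by blast
      moreover have "card ((e \<inter> Z) \<union> (e \<inter> (V - Z))) = card (e \<inter> Z) + card (e \<inter> (V - Z))"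
        using e2(3) by (intro card_Un_disjoint) auto
      ultimately show ?thesis using e2(2) by simp
    qed
    show ?thesis
    proof (cases "e \<in> E \<and> e \<subseteq> Z")
      case True
      obtain u v where uv: "e = {u, v}" "u \<noteq> v" using e2(2) by (auto simp: card_2_iff)
      obtain S T where ST: "S \<in> P" "u \<in> A S" "T \<in> P" "v \<in> A T"
        using True uv by (auto simp: Z_def)
      have "S = T" using ends[OF ST(1,3)] A(2) ST True uv by blast
      then have "e \<subseteq> A S" using ST uv by auto
      then have "(if e \<in> E \<and> e \<subseteq> A S then 1 else (0::real)) = 1" using True by simp
      moreover have "(if e \<in> E \<and> e \<subseteq> A S then 1 else (0::real)) \<le> inside e"
        unfolding inside_def by (rule member_le_sum) (use ST(1) finP in auto)
      ultimately have "1 \<le> inside e" by simp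
      then show ?thesis using split by simp
    next
      case False
      then consider "e \<notin> E" | "\<not> e \<subseteq> Z" by blast
      then show ?thesis
      proof cases
        case 1
        then show ?thesis using split inside0[of e] by simp
      next
        case 2
        then have "e \<inter> (V - Z) \<noteq> {}" using e2 by blast
        then have "card (e \<inter> (V - Z)) > 0" using e2(3) by (simp add: card_gt_0_iff)
        then show ?thesis using split inside0[of e] by simp
      qed
    qed
  qed
  have "2 * real (card Z) = (\<Sum>e\<in>complete_edges V. real (card (e \<inter> Z)) * x e)"
    using deg[OF ZV] by simp
  also have "\<dots> \<le> (\<Sum>e\<in>complete_edges V.
      (2 * inside e + real (card (e \<inter> (V - Z))) + (if e \<in> E then 0 else 2)) * x e)"
    by (intro sum_mono mult_right_mono edge x0)
  also have "\<dots> = 2 * (\<Sum>e\<in>complete_edges V. inside e * x e)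
      + (\<Sum>e\<in>complete_edges V. real (card (e \<inter> (V - Z))) * x e)
      + (\<Sum>e\<in>complete_edges V. (if e \<in> E then 0 else 2) * x e)"
    by (simp add: distrib_right sum.distrib sum_distrib_left mult.assoc)
  also have "(\<Sum>e\<in>complete_edges V. real (card (e \<inter> (V - Z))) * x e) = 2 * real (card (V - Z))"
    by (rule deg) auto
  also have "(\<Sum>e\<in>complete_edges V. (if e \<in> E then 0 else 2) * x e) = 2 * (\<Sum>e\<in>complete_edges V - E. x e)"
  proof -
    have "(\<Sum>e\<in>complete_edges V - E. 2 * x e) = (\<Sum>e\<in>complete_edges V. (if e \<in> E then 0 else 2) * x e)"
      using fin by (intro sum.mono_neutral_cong_left) auto
    then show ?thesis by (simp add: sum_distrib_left)
  qed
  finally have 1: "real (card Z) \<le> (\<Sum>e\<in>complete_edges V. inside e * x e)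
      + real (card (V - Z)) + (\<Sum>e\<in>complete_edges V - E. x e)"
    by simp
  have "(\<Sum>e\<in>complete_edges V. inside e * x e)
      = (\<Sum>e\<in>complete_edges V. \<Sum>S\<in>P. if e \<in> E \<and> e \<subseteq> A S then x e else 0)"
    unfolding inside_def sum_distrib_right by (intro sum.cong refl) simp
  also have "\<dots> = (\<Sum>S\<in>P. \<Sum>e\<in>complete_edges V. if e \<in> E \<and> e \<subseteq> A S then x e else 0)"
    by (rule sum.swap)
  also have "\<dots> = (\<Sum>S\<in>P. \<Sum>e\<in>{e \<in> E. e \<subseteq> A S}. x e)"
    using E fin by (intro sum.cong[OF refl] sum.mono_neutral_cong_right) auto
  finally have 2: "(\<Sum>e\<in>complete_edges V. inside e * x e) = (\<Sum>S\<in>P. \<Sum>e\<in>{e \<in> E. e \<subseteq> A S}. x e)" .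
  have "(\<Sum>S\<in>P. g S) \<le> (\<Sum>S\<in>P. real (card (A S)) - (\<Sum>e\<in>{e \<in> E. e \<subseteq> A S}. x e) - real (card (S - A S)))"
    by (rule sum_mono) (rule A(3))
  also have "\<dots> = real (card Z) - (\<Sum>e\<in>complete_edges V. inside e * x e) - real (card (V - Z))"
    unfolding 2 cZ cVZ by (simp add: sum_subtractf)
  also have "\<dots> \<le> (\<Sum>e\<in>complete_edges V - E. x e)" using 1 by linarith
  finally show ?thesis unfolding g_def .
qed

subsection \<open>Path covers with few paths\<close>

lemma card_partition_sum:
  assumes "finite V" "partition_on V P"
  shows "(\<Sum>S\<in>P. card S) = card V"
proof -
  have "finite P" using finite_elements[OF assms] .
  moreover have "\<Union>P = V" "disjoint P" using assms(2) by (auto simp: partition_on_def)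
  moreover have "finite S" if "S \<in> P" for S
    using that \<open>\<Union>P = V\<close> assms(1) by (metis Union_upper finite_subset)
  ultimately show ?thesis
    using card_Union_disjoint[of P] by (simp add: pairwise_def disjoint_def disjnt_def)
qed

text \<open>The union is at least as large as \<open>S\<close>, so its deficiency is at most that of
  \<open>S\<close>; the deficiency of \<open>T\<close> disappears.\<close>

lemma merged_deficiency_le:
  assumes "finite P" "S \<in> P" "T \<in> P" "S \<noteq> T" "finite S" "finite T"
  shows "(\<Sum>X\<in>insert (S \<union> T) (P - {S, T}). real (3 - card X)) \<le> (\<Sum>X\<in>P. real (3 - card X))"
proof -
  define d where "d = (\<lambda>X::'a set. real (3 - card X))"
  have d0: "d X \<ge> 0" for X by (simp add: d_def)
  have "card S \<le> card (S \<union> T)" using assms by (intro card_mono) auto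
  then have "d (S \<union> T) \<le> d S" by (simp add: d_def)
  moreover have "sum d (insert (S \<union> T) (P - {S, T})) \<le> d (S \<union> T) + sum d (P - {S, T})"
    using assms(1) d0 by (cases "S \<union> T \<in> P - {S, T}") (simp_all add: insert_absorb)
  moreover have "sum d P = d S + (d T + sum d (P - {S, T}))"
  proof -
    have "P = insert S (insert T (P - {S, T}))" using assms by blast
    moreover have "sum d (insert S (insert T (P - {S, T}))) = d S + (d T + sum d (P - {S, T}))"
      using assms(1,4) by simp
    ultimately show ?thesis by simp
  qed
  ultimately show ?thesis unfolding d_def[symmetric] using d0[of T] by simp
qed

text \<open>Among all path covers whose total deficiency is at most twice the weight that \<open>x\<close> places
  outside \<open>E\<close>, one with the fewest paths is unmergeable.\<close>

lemma small_path_cover: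
  assumes V: "finite V" "4 \<le> card V" and x: "subtour_feasible V x" and E: "E \<subseteq> complete_edges V"
  obtains P where "path_cover E V P"
    "81 * real (card P) \<le> 25 * real (card V) + 56 * (\<Sum>e\<in>complete_edges V - E. x e)"
proof -
  define k where "k = (\<Sum>e\<in>complete_edges V - E. x e)"
  have fin: "finite (complete_edges V)" "finite E"
    using finite_complete_edges[OF V(1)] E by (auto intro: finite_subset)
  have k0: "k \<ge> 0"
    unfolding k_def using subtour_bounds(1)[OF x] by (intro sum_nonneg) simp
  have graph: "e \<subseteq> V \<and> card e = 2" if "e \<in> E" for e
    using that E by (auto simp: complete_edges_def)
  have "sum x (complete_edges V) = sum x E + k"
    unfolding k_def using sum.subset_diff[OF E fin(1), of x] by simp
  then have xE: "sum x E = real (card V) - k"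
    using subtour_total[OF V(1) x] by simp
  have fm: "fractional_2_matching V E x"
    unfolding fractional_2_matching_def
  proof (intro conjI ballI)
    fix e assume "e \<in> E"
    then have "e \<in> complete_edges V" using E by blast
    then show "0 \<le> x e" "x e \<le> 1" using subtour_bounds[OF x] by simp_all
  next
    fix v assume v: "v \<in> V"
    have "(\<Sum>e\<in>{e \<in> E. v \<in> e}. x e) \<le> (\<Sum>e\<in>cut V {v}. x e)"
    proof (rule sum_mono2)
      show "finite (cut V {v})" using fin by (simp add: cut_def)
      show "{e \<in> E. v \<in> e} \<subseteq> cut V {v}" using E by (auto simp: cut_singleton)
      show "0 \<le> x e" if "e \<in> cut V {v} - {e \<in> E. v \<in> e}" for e
        using that subtour_bounds(1)[OF x, of e] by (simp add: cut_def)
    qed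
    then show "(\<Sum>e\<in>{e \<in> E. v \<in> e}. x e) \<le> 2" using subtour_degree[OF x v] by simp
  qed
  obtain I F where
    IF: "I \<subseteq> E" "F \<subseteq> E" "I \<inter> F = {}"
    and deg: "\<forall>v\<in>V. card {e \<in> F. v \<in> e} = 0 \<and> card {e \<in> I. v \<in> e} \<le> 2 \<or>
        card {e \<in> F. v \<in> e} = 2 \<and> card {e \<in> I. v \<in> e} = 1"
    and total: "(\<Sum>v\<in>V - \<Union>F. 2 - real (card {e \<in> I. v \<in> e})) \<le> 2 * (real (card V) - sum x E)"
    by (rule half_integral_2_matching[OF V(1) fin(2) _ fm]) (erule graph, rule that)
  obtain P0 where P0: "path_cover E V P0"
      "(\<Sum>S\<in>P0. real (3 - card S)) \<le> (\<Sum>v\<in>V - \<Union>F. 2 - real (card {e \<in> I. v \<in> e}))"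
    by (rule path_cover_of_half_integral[OF V(1) fin(2) _ IF deg]) (erule graph, rule that)
  define Q where "Q = (\<lambda>P::'a set set. (\<Sum>S\<in>P. real (3 - card S)) \<le> 2 * k)"
  have "Q P0" unfolding Q_def using P0(2) total xE by simp
  with P0(1) obtain P where
    P: "path_cover E V P" "Q P" and min: "\<And>P'. path_cover E V P' \<Longrightarrow> Q P' \<Longrightarrow> card P \<le> card P'"
    using min_path_cover_exists[of E V P0 Q] by metis
  have finP: "finite P" using path_cover_finite[OF P(1) V(1)] .
  have union: "\<Union>P = V" using P(1) by (simp add: path_cover_def partition_on_def)
  have finS: "finite S" if "S \<in> P" for S
    using that union V(1) by (metis Union_upper finite_subset)
  show thesis
  proof (cases "V \<in> P")
    \<comment> \<open>With a single path the claim is \<open>81 \<le> 25 * card V + 56 * k\<close>,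
      which holds from four vertices on.\<close>
    case True
    have "S = V" if "S \<in> P" for S
    proof (rule ccontr)
      assume "S \<noteq> V"
      then have "S \<inter> V = {}" using path_cover_disjoint[OF P(1) that True] by simp
      moreover have "S \<subseteq> V" using Union_upper[OF that] union by simp
      moreover have "S \<noteq> {}" using P(1) that by (auto simp: path_cover_def partition_on_def)
      ultimately show False by blast
    qed
    then have "P = {V}" using True by blast
    then show thesis using P(1) V(2) k0 by (intro that[of P]) (simp_all add: k_def)
  next
    case False
    have unmergeable: "{a, b} \<notin> E"
      if ST: "S \<in> P" "T \<in> P" "S \<noteq> T" and ab: "path_end E S a" "path_end E T b" for S T a b
    proof
      assume "{a, b} \<in> E"
      from path_cover_merge[OF P(1) ST ab this]
      have "path_cover E V (insert (S \<union> T) (P - {S, T}))" .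
      moreover have "Q (insert (S \<union> T) (P - {S, T}))"
        using merged_deficiency_le[OF finP ST finS[OF ST(1)] finS[OF ST(2)]] P(2)
        unfolding Q_def by linarith
      ultimately show False using min card_merge_less[OF finP ST] by fastforce
    qed
    define g where "g = (\<lambda>S::'a set. if card S \<le> 3 then 1 else 3 - real (card S))"
    have g: "sum g P \<le> k"
      unfolding g_def k_def by (rule unmergeable_cover_surplus[OF V(1) x E P(1) False unmergeable])
    \<comment> \<open>The weights give exactly 81 for sizes 1, 2 and 3: \<open>25 + 50 + 6\<close>,
      \<open>50 + 25 + 6\<close> and \<open>75 + 0 + 6\<close>. For \<open>s \<ge> 4\<close> the
      term is \<open>19 * s + 18\<close>, at least 94.\<close>
    have "81 * real (card P) = (\<Sum>S\<in>P. 81)" by simp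
    also have "\<dots> \<le> (\<Sum>S\<in>P. 25 * real (card S) + 25 * real (3 - card S) + 6 * g S)"
      by (rule sum_mono) (auto simp: g_def of_nat_diff)
    also have "\<dots> = 25 * real (\<Sum>S\<in>P. card S) + 25 * (\<Sum>S\<in>P. real (3 - card S)) + 6 * sum g P"
      by (simp add: sum.distrib sum_distrib_left)
    also have "(\<Sum>S\<in>P. card S) = card V"
      using card_partition_sum[OF V(1)] P(1) by (simp add: path_cover_def)
    finally have "81 * real (card P) \<le> 25 * real (card V) + 56 * k"
      using P(2) g unfolding Q_def by linarith
    then show thesis using P(1) by (intro that[of P]) (simp_all add: k_def)
  qed
qed

subsection \<open>From path covers to tours\<close>

fun path_cost :: "('a set \<Rightarrow> real) \<Rightarrow> 'a list \<Rightarrow> real" where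
  "path_cost c [] = 0"
| "path_cost c [u] = 0"
| "path_cost c (u # v # l) = c {u, v} + path_cost c (v # l)"

lemma path_cost_append:
  "l \<noteq> [] \<Longrightarrow> m \<noteq> [] \<Longrightarrow>
    path_cost c (l @ m) = path_cost c l + c {last l, hd m} + path_cost c m"
proof (induction c l rule: path_cost.induct)
  case (2 c u)
  then show ?case by (cases m) simp_all
qed simp_all

lemma path_cost_unit_edges:
  "successively (\<lambda>u v. c {u, v} = 1) l \<Longrightarrow> l \<noteq> [] \<Longrightarrow> path_cost c l = real (length l) - 1"
  by (induction c l rule: path_cost.induct) simp_all

lemma path_cost_sum: "path_cost c l = (\<Sum>i<length l - 1. c {l ! i, l ! Suc i})"
proof (induction c l rule: path_cost.induct)
  case (3 c u v l)
  then show ?case by (simp add: sum.lessThan_Suc_shift del: sum.lessThan_Suc)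
qed simp_all

lemma cycle_edges_subset:
  assumes "distinct vs" "2 \<le> length vs"
  shows "cycle_edges vs \<subseteq> complete_edges (set vs)"
proof
  fix e assume "e \<in> cycle_edges vs"
  then obtain i where i: "i < length vs" "e = {vs ! i, vs ! (Suc i mod length vs)}"
    by (auto simp: cycle_edges_def)
  have "Suc i mod length vs < length vs" using i(1) by (intro mod_less_divisor) linarith
  moreover have "Suc i mod length vs \<noteq> i" using i assms(2) by (simp add: mod_Suc)
  ultimately show "e \<in> complete_edges (set vs)"
    using i assms(1) by (simp add: complete_edges_def nth_eq_iff_index_eq)
qed

text \<open>Only an inequality, since \<open>cycle_edges vs\<close> is a set and different positions
  of \<open>vs\<close> may yield the same edge.\<close>

lemma cycle_cost_le:
  assumes "vs \<noteq> []" and c: "\<And>e. e \<in> cycle_edges vs \<Longrightarrow> 0 \<le> c e"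
  shows "(\<Sum>e\<in>cycle_edges vs. c e) \<le> path_cost c vs + c {last vs, hd vs}"
proof -
  define f where "f = (\<lambda>i. {vs ! i, vs ! (Suc i mod length vs)})"
  obtain n where n: "length vs = Suc n" using assms(1) by (cases vs) auto
  have eq: "cycle_edges vs = f ` {..<Suc n}" by (auto simp: cycle_edges_def f_def n)
  have "(\<Sum>e\<in>cycle_edges vs. c e) \<le> (\<Sum>i<Suc n. c (f i))"
    using sum_image_le[of "{..<Suc n}" c f] c unfolding eq by (simp add: o_def del: sum.lessThan_Suc)
  also have "\<dots> = (\<Sum>i<n. c (f i)) + c (f n)" by simp
  also have "(\<Sum>i<n. c (f i)) = path_cost c vs"
    unfolding path_cost_sum by (rule sum.cong) (simp_all add: n f_def)
  also have "f n = {last vs, hd vs}"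
    using assms(1) n by (simp add: f_def last_conv_nth hd_conv_nth)
  finally show ?thesis .
qed

text \<open>On \<open>n\<close> vertices, \<open>p\<close> paths have \<open>n - p\<close> edges of
  cost 1, and \<open>p - 1\<close> edges of cost at most 2 join them: \<open>n + p - 2\<close> in
  all. The remaining 2 is reserved for the edge that closes the tour.\<close>

lemma concatenate_paths:
  assumes "finite P" "P \<noteq> {}" "disjoint P" "\<And>S. S \<in> P \<Longrightarrow> \<exists>l. hamiltonian_path E S l"
    and c1: "\<And>e. e \<in> E \<Longrightarrow> c e = 1"
    and c2: "\<And>u v. u \<in> \<Union>P \<Longrightarrow> v \<in> \<Union>P \<Longrightarrow> u \<noteq> v \<Longrightarrow> c {u, v} \<le> 2"
  shows "\<exists>vs. distinct vs \<and> set vs = \<Union>P \<and>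
    path_cost c vs + 2 \<le> real (length vs) + real (card P)"
  using assms(1-4) c2
proof (induction P rule: finite_ne_induct)
  case (singleton S)
  then obtain l where l: "hamiltonian_path E S l" by blast
  then have "successively (\<lambda>u v. c {u, v} = 1) l"
    using c1 by (auto simp: hamiltonian_path_def elim: successively_mono)
  then have "path_cost c l = real (length l) - 1"
    using l by (intro path_cost_unit_edges) (auto simp: hamiltonian_path_def)
  then show ?case using l by (intro exI[of _ l]) (simp add: hamiltonian_path_def)
next
  case (insert S P)
  have "disjoint P" using insert.prems(1) by (auto simp: disjoint_def)
  moreover have "c {u, v} \<le> 2" if "u \<in> \<Union>P" "v \<in> \<Union>P" "u \<noteq> v" for u v
    using insert.prems(3)[of u v] that by simp
  ultimately obtain vs where vs: "distinct vs" "set vs = \<Union>P"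
    "path_cost c vs + 2 \<le> real (length vs) + real (card P)"
    using insert.IH insert.prems(2) by (metis insertCI)
  obtain l where l: "hamiltonian_path E S l" using insert.prems(2) by blast
  then have l': "l \<noteq> []" "distinct l" "set l = S" by (auto simp: hamiltonian_path_def)
  have "successively (\<lambda>u v. c {u, v} = 1) l"
    using c1 l by (auto simp: hamiltonian_path_def elim: successively_mono)
  then have cl: "path_cost c l = real (length l) - 1" using l'(1) by (rule path_cost_unit_edges)
  have dis: "S \<inter> \<Union>P = {}"
  proof -
    have "S \<inter> T = {}" if "T \<in> P" for T
      using insert.prems(1) insert.hyps(3) that unfolding disjoint_def by (metis insertCI)
    then show ?thesis by blast
  qed
  obtain T where T: "T \<in> P" using insert.hyps(2) by blast
  then obtain m where "hamiltonian_path E T m" using insert.prems(2) by blast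
  then have ne: "vs \<noteq> []" using T vs(2) by (auto simp: hamiltonian_path_def)
  have "last l \<in> S" "hd vs \<in> \<Union>P"
    using last_in_set[OF l'(1)] hd_in_set[OF ne] l'(3) vs(2) by simp_all
  moreover from this have "last l \<noteq> hd vs" using dis by auto
  ultimately have "c {last l, hd vs} \<le> 2"
    using insert.prems(3)[of "last l" "hd vs"] by simp
  then have "path_cost c (l @ vs) + 2 \<le> real (length (l @ vs)) + real (card (insert S P))"
    using path_cost_append[OF l'(1) ne, of c] cl vs(3) insert.hyps by simp
  moreover have "distinct (l @ vs)" "set (l @ vs) = \<Union>(insert S P)"
    using l' vs dis by auto
  ultimately show ?case by blast
qed

lemma finite_tour_costs: "finite V \<Longrightarrow> finite {\<Sum>e\<in>T. c e |T. is_tour V T}"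
proof -
  assume "finite V"
  then have "finite (Pow (complete_edges V))" by (simp add: finite_complete_edges)
  moreover have "{T. is_tour V T} \<subseteq> Pow (complete_edges V)"
    using cycle_edges_subset by (fastforce simp: is_tour_def)
  ultimately have "finite {T. is_tour V T}" by (rule finite_subset[rotated])
  then show ?thesis by simp
qed

lemma min_tour_cost_le:
  assumes "finite V" "is_tour V T"
  shows "min_tour_cost V c \<le> (\<Sum>e\<in>T. c e)"
  unfolding min_tour_cost_def using finite_tour_costs[OF assms(1)] assms(2)
  by (intro Min_le) auto

section \<open>Nonemptiness of the feasible region\<close>

lemma card_cut:
  assumes "finite V" "S \<subseteq> V"
  shows "card (cut V S) = card S * (card V - card S)"
proof -
  have "cut V S = (\<lambda>(u, v). {u, v}) ` (S \<times> (V - S))"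
  proof (intro equalityI subsetI)
    fix e assume e: "e \<in> cut V S"
    then have "card (e \<inter> S) = 1" by (simp add: cut_def)
    then obtain u where u: "e \<inter> S = {u}" by (rule card_1_singletonE)
    have e2: "card e = 2" "e \<subseteq> V" using e by (simp_all add: cut_def complete_edges_def)
    have "u \<in> e" "u \<in> S" using u by blast+
    obtain a b where ab: "e = {a, b}" "a \<noteq> b" using e2(1) by (auto simp: card_2_iff)
    obtain v where v: "e = {u, v}" "u \<noteq> v"
    proof (cases "u = a")
      case True
      then show thesis using ab that[of b] by simp
    next
      case False
      then have "u = b" using \<open>u \<in> e\<close> ab(1) by simp
      then show thesis using ab that[of a] by (simp add: insert_commute)
    qed
    have "v \<notin> S"
    proof
      assume "v \<in> S"
      then have "v \<in> e \<inter> S" using v(1) by simp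
      then show False using u v(2) by simp
    qed
    moreover have "v \<in> V" using v(1) e2(2) by simp
    ultimately have "v \<in> V - S" by simp
    then show "e \<in> (\<lambda>(u, v). {u, v}) ` (S \<times> (V - S))"
      using v(1) \<open>u \<in> S\<close> by (intro image_eqI[of _ _ "(u, v)"]) simp_all
  next
    fix e assume "e \<in> (\<lambda>(u, v). {u, v}) ` (S \<times> (V - S))"
    then obtain u v where uv: "e = {u, v}" "u \<in> S" "v \<in> V" "v \<notin> S" by auto
    then have "e \<inter> S = {u}" "u \<noteq> v" by auto
    then show "e \<in> cut V S" using uv assms(2) by (auto simp: cut_def complete_edges_def)
  qed
  moreover have "inj_on (\<lambda>(u, v). {u, v}) (S \<times> (V - S))"
    by (auto simp: inj_on_def doubleton_eq_iff)
  ultimately show ?thesis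
    using assms by (simp add: card_image card_cartesian_product card_Diff_subset finite_subset)
qed

lemma subtour_feasible_uniform:
  assumes "finite V" "3 \<le> card V"
  shows "subtour_feasible V (\<lambda>_. 2 / (real (card V) - 1))"
  unfolding subtour_feasible_def
proof (intro conjI ballI allI impI)
  fix v assume "v \<in> V"
  define m where "m = real (card V) - 1"
  from \<open>v \<in> V\<close> have "card (cut V {v}) = card V - 1" using card_cut[OF assms(1), of "{v}"] by simp
  then have card: "real (card (cut V {v})) = m"
    using assms(2) by (simp add: m_def of_nat_diff)
  have "m \<noteq> 0" using assms(2) by (simp add: m_def)
  with card have "(\<Sum>e\<in>cut V {v}. 2 / m) = 2" by simp
  then show "(\<Sum>e\<in>cut V {v}. 2 / (real (card V) - 1)) = 2" by (simp only: m_def)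
next
  fix S assume S: "S \<subset> V \<and> 3 \<le> card S \<and> card S + 3 \<le> card V"
  then have "card (cut V S) = card S * (card V - card S)" using card_cut[OF assms(1), of S] by auto
  then have "real (card (cut V S)) = real (card S) * (real (card V) - real (card S))"
    using S by (simp add: of_nat_diff)
  \<comment> \<open>With \<open>s = card S\<close> and \<open>n = card V\<close>, this product
    equals \<open>s * (n - s) - (n - 1)\<close>.\<close>
  moreover have "0 \<le> (real (card S) - 1) * (real (card V) - real (card S) - 1)"
    using S by (intro mult_nonneg_nonneg) auto
  ultimately have "real (card V) - 1 \<le> real (card (cut V S))" by (simp add: algebra_simps)
  then show "2 \<le> (\<Sum>e\<in>cut V S. 2 / (real (card V) - 1))"
    using assms(2) by (simp add: pos_le_divide_eq)
qed (use assms(2) in \<open>simp_all add: divide_simps\<close>)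

section \<open>Tours against the LP optimum\<close>

lemma min_tour_cost_le_lp_solution:
  assumes V: "finite V" "3 \<le> card V" and c: "\<And>e. e \<in> complete_edges V \<Longrightarrow> c e \<in> {1, 2}"
    and x: "subtour_feasible V x"
  shows "min_tour_cost V c \<le> 106 / 81 * (\<Sum>e\<in>complete_edges V. c e * x e)"
proof -
  have fin: "finite (complete_edges V)" using finite_complete_edges[OF V(1)] .
  have c0: "0 \<le> c e" if "e \<in> complete_edges V" for e using c[OF that] by auto
  have total: "(\<Sum>e\<in>complete_edges V. x e) = real (card V)" using subtour_total[OF V(1) x] .
  show ?thesis
  proof (cases "card V = 3")
    \<comment> \<open>Here one path would be too many for the bound on covers, as
      \<open>81 > 25 * 3\<close>. But three edges with values at most 1 and total 3 all have value
      1, so the LP solution is the tour itself.\<close>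
    case True
    obtain vs where vs: "set vs = V" "distinct vs" using finite_distinct_list[OF V(1)] by blast
    have len: "length vs = 3" using vs True distinct_card by metis
    then have "is_tour V (cycle_edges vs)" using vs by (auto simp: is_tour_def)
    then have "min_tour_cost V c \<le> (\<Sum>e\<in>cycle_edges vs. c e)" by (rule min_tour_cost_le[OF V(1)])
    also have "\<dots> \<le> (\<Sum>e\<in>complete_edges V. c e)"
      using cycle_edges_subset[OF vs(2)] len vs(1) fin c0 by (intro sum_mono2) auto
    finally have tour: "min_tour_cost V c \<le> (\<Sum>e\<in>complete_edges V. c e)" .
    have "card (complete_edges V) = 3 choose 2"
      unfolding complete_edges_def using n_subsets[OF V(1), of 2] True by simp
    then have "(\<Sum>e\<in>complete_edges V. 1 - x e) = 0"
      using total True by (simp add: sum_subtractf numeral_2_eq_2 numeral_3_eq_3)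
    then have "\<forall>e\<in>complete_edges V. 1 - x e = 0"
      using subtour_bounds(2)[OF x] fin by (subst (asm) sum_nonneg_eq_0_iff) auto
    then have "(\<Sum>e\<in>complete_edges V. c e * x e) = (\<Sum>e\<in>complete_edges V. c e)"
      by (intro sum.cong) auto
    moreover have "0 \<le> (\<Sum>e\<in>complete_edges V. c e)" using c0 by (rule sum_nonneg)
    ultimately show ?thesis using tour by simp
  next
    case False
    then have V4: "4 \<le> card V" using V(2) by simp
    define E where "E = {e \<in> complete_edges V. c e = 1}"
    define k where "k = (\<Sum>e\<in>complete_edges V - E. x e)"
    have E: "E \<subseteq> complete_edges V" by (auto simp: E_def)
    have k0: "0 \<le> k"
      unfolding k_def using subtour_bounds(1)[OF x] by (intro sum_nonneg) simp
    have lp: "(\<Sum>e\<in>complete_edges V. c e * x e) = real (card V) + k"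
    proof -
      have "(\<Sum>e\<in>complete_edges V. c e * x e)
          = (\<Sum>e\<in>complete_edges V - E. c e * x e) + (\<Sum>e\<in>E. c e * x e)"
        by (rule sum.subset_diff[OF E fin])
      also have "(\<Sum>e\<in>complete_edges V - E. c e * x e) = (\<Sum>e\<in>complete_edges V - E. 2 * x e)"
        using c by (intro sum.cong) (auto simp: E_def)
      also have "(\<Sum>e\<in>E. c e * x e) = (\<Sum>e\<in>E. x e)" by (intro sum.cong) (auto simp: E_def)
      finally show ?thesis
        using sum.subset_diff[OF E fin, of x] total by (simp add: k_def sum_distrib_left[symmetric])
    qed
    obtain P where P: "path_cover E V P" "81 * real (card P) \<le> 25 * real (card V) + 56 * k"
      using small_path_cover[OF V(1) V4 x E] unfolding k_def by blast
    have union: "\<Union>P = V" and "disjoint P" and paths: "\<And>S. S \<in> P \<Longrightarrow> \<exists>l. hamiltonian_path E S l"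
      using P(1) by (auto simp: path_cover_def partition_on_def)
    have ne: "P \<noteq> {}" using union V(2) by auto
    have pair: "c {u, v} \<le> 2" if "u \<in> V" "v \<in> V" "u \<noteq> v" for u v
      using c[of "{u, v}"] that by (auto simp: complete_edges_def)
    obtain vs where vs: "distinct vs" "set vs = V"
      "path_cost c vs + 2 \<le> real (length vs) + real (card P)"
      using concatenate_paths[OF path_cover_finite[OF P(1) V(1)] ne \<open>disjoint P\<close> paths, of c]
        pair unfolding union by (auto simp: E_def)
    have len: "length vs = card V" using vs distinct_card by metis
    then have ne_vs: "vs \<noteq> []" using V(2) by auto
    have "is_tour V (cycle_edges vs)" using vs len V(2) by (auto simp: is_tour_def)
    then have "min_tour_cost V c \<le> (\<Sum>e\<in>cycle_edges vs. c e)" by (rule min_tour_cost_le[OF V(1)])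
    also have "\<dots> \<le> path_cost c vs + c {last vs, hd vs}"
      using cycle_edges_subset[OF vs(1)] len V(2) vs(2) c0 by (intro cycle_cost_le[OF ne_vs]) auto
    also have "c {last vs, hd vs} \<le> 2"
    proof (rule pair)
      show "last vs \<in> V" "hd vs \<in> V" using ne_vs vs(2) by (metis last_in_set, metis hd_in_set)
      show "last vs \<noteq> hd vs"
        using vs(1) len V(2) ne_vs nth_eq_iff_index_eq[of vs "length vs - 1" 0]
        by (simp add: hd_conv_nth last_conv_nth)
    qed
    finally have "min_tour_cost V c \<le> real (card V) + real (card P)" using vs(3) len by simp
    \<comment> \<open>The coefficient of \<open>card V\<close> is
      \<open>1 + 25 / 81 = 106 / 81\<close>; that of \<open>k\<close> is \<open>56 / 81\<close>,
      which is smaller.\<close>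
    then have "min_tour_cost V c \<le> 106 / 81 * (real (card V) + k)" using P(2) k0 by argo
    then show ?thesis unfolding lp .
  qed
qed

lemma min_tour_cost_le_subtour_lp:
  assumes V: "finite V" "3 \<le> card V" and c: "\<And>e. e \<in> complete_edges V \<Longrightarrow> c e \<in> {1, 2}"
  shows "min_tour_cost V c \<le> 106 / 81 * subtour_lp_value V c"
proof -
  have "81 / 106 * min_tour_cost V c \<le> subtour_lp_value V c"
    unfolding subtour_lp_value_def
  proof (rule cINF_greatest)
    show "{x. subtour_feasible V x} \<noteq> {}" using subtour_feasible_uniform[OF V] by blast
    fix x assume "x \<in> {x. subtour_feasible V x}"
    then have "min_tour_cost V c \<le> 106 / 81 * (\<Sum>e\<in>complete_edges V. c e * x e)"
      by (intro min_tour_cost_le_lp_solution V c) simp_all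
    then show "81 / 106 * min_tour_cost V c \<le> (\<Sum>e\<in>complete_edges V. c e * x e)"
      by simp
  qed
  then show ?thesis by simp
qed

text \<open>This justifies dividing by the LP value: costs of at least 1 make it at least
  \<open>card V\<close>.\<close>

lemma subtour_lp_value_pos:
  assumes V: "finite V" "3 \<le> card V" and c: "\<And>e. e \<in> complete_edges V \<Longrightarrow> c e \<in> {1, 2}"
  shows "0 < subtour_lp_value V c"
proof -
  have "real (card V) \<le> subtour_lp_value V c"
    unfolding subtour_lp_value_def
  proof (rule cINF_greatest)
    show "{x. subtour_feasible V x} \<noteq> {}" using subtour_feasible_uniform[OF V] by blast
    fix x assume "x \<in> {x. subtour_feasible V x}"
    then have x: "subtour_feasible V x" by simp
    have "x e \<le> c e * x e" if "e \<in> complete_edges V" for e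
      using c[OF that] subtour_bounds(1)[OF x that] by auto
    then have "(\<Sum>e\<in>complete_edges V. x e) \<le> (\<Sum>e\<in>complete_edges V. c e * x e)" by (rule sum_mono)
    then show "real (card V) \<le> (\<Sum>e\<in>complete_edges V. c e * x e)"
      using subtour_total[OF V(1) x] by simp
  qed
  then show ?thesis using V(2) by simp
qed

theorem theorem2:
  shows "(\<forall>(n::nat) (V::'a set) (c::'a set \<Rightarrow> real).
            n \<ge> 3 \<and> finite V \<and> card V = n \<and> (\<forall>e\<in>complete_edges V. c e \<in> {1, 2}) \<longrightarrow>
            min_tour_cost V c \<le> 106 / 81 * subtour_lp_value V c)
       \<and> subtour_integrality_gap
            {(V::nat set, c::nat set \<Rightarrow> real). one_two_instance V c} \<le> ereal (106 / 81)"
proof (intro conjI allI impI)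
  fix n :: nat and V :: "'a set" and c :: "'a set \<Rightarrow> real"
  assume "n \<ge> 3 \<and> finite V \<and> card V = n \<and> (\<forall>e\<in>complete_edges V. c e \<in> {1, 2})"
  then show "min_tour_cost V c \<le> 106 / 81 * subtour_lp_value V c"
    by (intro min_tour_cost_le_subtour_lp) auto
next
  show "subtour_integrality_gap
      {(V::nat set, c::nat set \<Rightarrow> real). one_two_instance V c} \<le> ereal (106 / 81)"
    unfolding subtour_integrality_gap_def
  proof (rule SUP_least)
    fix p :: "nat set \<times> (nat set \<Rightarrow> real)"
    assume p: "p \<in> {(V, c). one_two_instance V c}"
    obtain V c where Vc: "p = (V, c)" by (cases p)
    then have V: "finite V" "3 \<le> card V" and c: "\<And>e. e \<in> complete_edges V \<Longrightarrow> c e \<in> {1, 2}"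
      using p by (auto simp: one_two_instance_def)
    have "min_tour_cost V c / subtour_lp_value V c \<le> 106 / 81"
      using min_tour_cost_le_subtour_lp[OF V c] subtour_lp_value_pos[OF V c]
      by (simp add: pos_divide_le_eq)
    then show "(case p of (V, c) \<Rightarrow> ereal (min_tour_cost V c / subtour_lp_value V c)) \<le> ereal (106 / 81)"
      by (simp add: Vc)
  qed
qed

end
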